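(* Let $k\ge 2$ be an integer. For each positive integer $m$, let $\mathcal{C}_m$ denote the family of $m$-critical $(P_5,\overline{P}_5)$-free graphs. A graph $G$ belongs to $\mathcal{C}_k$ if and only if it can be obtained by one of the following two constructions: (1) $G$ is the join of a member of $\mathcal{C}_{k_1}$ and a member of $\mathcal{C}_{k_2}$, for some positive integers $k_1,k_2$ with $k_1+k_2=k$; (2) $G$ is a buoy with bags $B_1,\ldots,B_5$ such that, for each $i$ (indices mod $5$), the graph $B_i$ is a member of $\mathcal{C}_{k_i}$, where $k_1,\ldots,k_5$ are positive integers satisfying $k_i+k_{i+1}\le k-1$ for each $i \bmod 5$ and $\sum_{i=1}^5 k_i=2k-1$.
   Context: All graphs are finite and simple. A graph is $(P_5,\overline{P}_5)$-free if it contains no induced subgraph isomorphic to the path $P_5$ on five vertices or to its complement $\overline{P}_5$. A graph is $k$-critical if its chromatic number is $k$ and every proper induced subgraph is $(k-1)$-colorable. The join of graphs $G$ and $H$ is obtained from disjoint copies of $G$ and $H$ by adding all edges between a vertex of $G$ and a vertex of $H$. A buoy is a graph obtained from the $5$-cycle $C_5$ on vertices $x_1,\ldots,x_5$ (in cyclic order) by replacing each $x_i$ by a nonempty graph $B_i$ (the bags), where two vertices in different bags $B_i,B_j$ are adjacent if and only if $x_ix_j$ is an edge of the $C_5$ (i.e. $j=i\pm 1 \bmod 5$), and edges inside each $B_i$ are those of $B_i$. *)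

theory Defs
  imports Main
begin

datatype 'a graph = Graph (verts: "'a set") (adj: "'a \<Rightarrow> 'a \<Rightarrow> bool")

definition simple_graph :: "'a graph \<Rightarrow> bool" where
  "simple_graph G \<longleftrightarrow>
     finite (verts G) \<and>
     (\<forall>x y. adj G x y \<longrightarrow> x \<in> verts G \<and> y \<in> verts G) \<and>
     (\<forall>x y. adj G x y \<longrightarrow> adj G y x) \<and>
     (\<forall>x. \<not> adj G x x)"

definition graph_iso :: "'a graph \<Rightarrow> 'b graph \<Rightarrow> bool" where
  "graph_iso G H \<longleftrightarrow>
     (\<exists>f. bij_betw f (verts G) (verts H) \<and>
          (\<forall>x\<in>verts G. \<forall>y\<in>verts G. adj G x y \<longleftrightarrow> adj H (f x) (f y)))"

definition induced :: "'a graph \<Rightarrow> 'a set \<Rightarrow> 'a graph" where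
  "induced G S = Graph (verts G \<inter> S) (\<lambda>x y. adj G x y \<and> x \<in> S \<and> y \<in> S)"

definition complement :: "'a graph \<Rightarrow> 'a graph" where
  "complement G =
     Graph (verts G) (\<lambda>x y. x \<in> verts G \<and> y \<in> verts G \<and> x \<noteq> y \<and> \<not> adj G x y)"

definition free_of :: "'b graph \<Rightarrow> 'a graph \<Rightarrow> bool" where
  "free_of H G \<longleftrightarrow> \<not> (\<exists>S\<subseteq>verts G. graph_iso (induced G S) H)"

definition path_graph :: "nat \<Rightarrow> nat graph" where
  "path_graph n = Graph {..<n} (\<lambda>i j. i < n \<and> j < n \<and> (j = i + 1 \<or> i = j + 1))"

text \<open>Intended for \<open>n \<ge> 3\<close> only; \<open>n = 1\<close> would give a loop.\<close>

definition cycle_graph :: "nat \<Rightarrow> nat graph" where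
  "cycle_graph n =
     Graph {..<n} (\<lambda>i j. i < n \<and> j < n \<and> (j = (i + 1) mod n \<or> i = (j + 1) mod n))"

definition P5_coP5_free :: "'a graph \<Rightarrow> bool" where
  "P5_coP5_free G \<longleftrightarrow> free_of (path_graph 5) G \<and> free_of (complement (path_graph 5)) G"

definition colorable :: "nat \<Rightarrow> 'a graph \<Rightarrow> bool" where
  "colorable k G \<longleftrightarrow>
     (\<exists>c :: 'a \<Rightarrow> nat. (\<forall>x\<in>verts G. c x < k) \<and>
        (\<forall>x\<in>verts G. \<forall>y\<in>verts G. adj G x y \<longrightarrow> c x \<noteq> c y))"

definition chromatic_number :: "'a graph \<Rightarrow> nat" where
  "chromatic_number G = (LEAST k. colorable k G)"

definition critical :: "nat \<Rightarrow> 'a graph \<Rightarrow> bool" where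
  "critical k G \<longleftrightarrow>
     chromatic_number G = k \<and> (\<forall>S. S \<subset> verts G \<longrightarrow> colorable (k - 1) (induced G S))"

definition critical_family :: "nat \<Rightarrow> 'a graph set" where
  "critical_family m = {G. simple_graph G \<and> critical m G \<and> P5_coP5_free G}"

definition graph_join :: "'a graph \<Rightarrow> 'b graph \<Rightarrow> ('a + 'b) graph" where
  "graph_join G H = Graph (verts G <+> verts H)
     (\<lambda>u v. case (u, v) of
        (Inl x, Inl y) \<Rightarrow> adj G x y
      | (Inr x, Inr y) \<Rightarrow> adj H x y
      | (Inl x, Inr y) \<Rightarrow> x \<in> verts G \<and> y \<in> verts H
      | (Inr x, Inl y) \<Rightarrow> x \<in> verts H \<and> y \<in> verts G)"

text \<open>Each vertex \<open>i\<close> of \<open>H\<close> is replaced by the graph \<open>B i\<close>.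
  The pairs \<open>(i, x)\<close> keep the copies disjoint.\<close>

definition substitute :: "'i graph \<Rightarrow> ('i \<Rightarrow> 'a graph) \<Rightarrow> ('i \<times> 'a) graph" where
  "substitute H B = Graph (SIGMA i:verts H. verts (B i))
     (\<lambda>(i, x) (j, y). i \<in> verts H \<and> j \<in> verts H \<and> x \<in> verts (B i) \<and> y \<in> verts (B j) \<and>
        (if i = j then adj (B i) x y else adj H i j))"

text \<open>The bags are indexed by \<open>0, \<dots>, 4\<close>; values of \<open>B\<close> at other indices are irrelevant.\<close>

definition is_buoy :: "'b graph \<Rightarrow> (nat \<Rightarrow> 'a graph) \<Rightarrow> bool" where
  "is_buoy G B \<longleftrightarrow>
     (\<forall>i<5. simple_graph (B i) \<and> verts (B i) \<noteq> {}) \<and>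
     graph_iso G (substitute (cycle_graph 5) B)"

end

theory Submission
  imports Defs
begin

text \<open>The chromatic number of a blow-up depends only on those of its bags: it is the least number of
  colours that can be distributed over the bags so that adjacent bags get disjoint sets. For a
  two-vertex join this is the sum of the weights; for the 5-cycle it is governed by the sums over
  edges and by half of the total weight. This settles both directions once a critical graph is known
  to be a join or a buoy.

  For the latter, a maximal buoy containing an induced 5-cycle is a module. Take a smallest
  cutset \<open>C\<close> of a critical graph that is neither a join nor a buoy. No induced 5-cycle can meet
  \<open>C\<close> and both sides, for the neighbourhood of the maximal buoy around it would be a smaller
  cutset. Excluding paths and houses, any two nonadjacent vertices of \<open>C\<close> then have the same
  neighbours outside \<open>C\<close>, so the co-components of \<open>C\<close> are modules, and optimal colourings of
  the two sides can be made to agree on \<open>C\<close>: this contradicts criticality.\<close>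

section \<open>Colourings\<close>

text \<open>Where \<open>2 * k - 1\<close> comes from: a colour serves at most two bags of a
  5-cycle, so K colours have total capacity \<open>2 * K\<close>, besides the capacity K of each
  edge of bags. In a critical buoy, deleting a vertex off an edge keeps the weights of that edge, so
  no edge exceeds k - 1. Hence k - 1 colours can fail only through the total, and as they suffice
  after any deletion, the total exceeds \<open>2 * (k - 1)\<close> by exactly one.

  The obstacle in the structural half is that colourings of the two sides may partition the cutset
  differently. Co-components that are modules remove it, since each can be recoloured on its own.
  For nonadjacent d and d' in C, short paths through the two sides have two or three edges. Two of
  three edges contain an induced path on five vertices, and one of each length form an induced
  5-cycle. So there are common neighbours on both sides, and with them a vertex that sees only one
  of d and d' leads to a path or a house.\<close>

definition proper :: "'a graph \<Rightarrow> 'a set \<Rightarrow> ('a \<Rightarrow> 'c) \<Rightarrow> bool" where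
  "proper G S c \<longleftrightarrow> (\<forall>x\<in>S. \<forall>y\<in>S. adj G x y \<longrightarrow> c x \<noteq> c y)"

text \<open>Keeps the ambient graph fixed and varies only the vertex set, so that bags, sides of a
  cutset and proper subsets need no nested induced graphs.\<close>

definition chi :: "'a graph \<Rightarrow> 'a set \<Rightarrow> nat" where
  "chi G S = chromatic_number (induced G S)"

lemma simple_graphD:
  assumes "simple_graph G"
  shows "finite (verts G)" "adj G x y \<Longrightarrow> x \<in> verts G" "adj G x y \<Longrightarrow> y \<in> verts G"
    "adj G x y \<longleftrightarrow> adj G y x" "\<not> adj G x x"
  using assms by (auto simp: simple_graph_def)

lemma simple_graph_induced: "simple_graph G \<Longrightarrow> simple_graph (induced G S)"
  by (auto simp: simple_graph_def induced_def)

lemma colorable_induced: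
  assumes "S \<subseteq> verts G"
  shows "colorable k (induced G S) \<longleftrightarrow> (\<exists>c. c ` S \<subseteq> {..<k} \<and> proper G S c)"
  using assms by (auto simp: colorable_def induced_def proper_def image_subset_iff Int_absorb1)

lemma proper_comp: "inj_on h (c ` S) \<Longrightarrow> proper G S c \<Longrightarrow> proper G S (h \<circ> c)"
  unfolding proper_def inj_on_def by auto

lemma proper_subset: "proper G S c \<Longrightarrow> T \<subseteq> S \<Longrightarrow> proper G T c"
  unfolding proper_def by blast

lemma colorable_mono: "colorable k G \<Longrightarrow> k \<le> l \<Longrightarrow> colorable l G"
  unfolding colorable_def by (meson order_less_le_trans)

lemma colorable_card:
  fixes G :: "'a graph" and c :: "'a \<Rightarrow> 'c"
  assumes "finite S" "S \<subseteq> verts G" "proper G S c"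
  shows "colorable (card (c ` S)) (induced G S)"
proof -
  obtain h where h: "bij_betw h (c ` S) {0..<card (c ` S)}"
    using ex_bij_betw_finite_nat assms(1) by blast
  have "proper G S (h \<circ> c)"
    by (rule proper_comp) (use h assms in \<open>auto simp: bij_betw_def\<close>)
  moreover have "(h \<circ> c) ` S \<subseteq> {..<card (c ` S)}"
    using h by (auto simp: bij_betw_def image_comp[symmetric])
  ultimately show ?thesis using colorable_induced[OF assms(2)] by blast
qed

lemma chi_le_iff:
  assumes "simple_graph G" "S \<subseteq> verts G"
  shows "chi G S \<le> k \<longleftrightarrow> colorable k (induced G S)"
proof
  have fin: "finite S" using assms finite_subset simple_graphD(1) by blast
  \<comment> \<open>With the vertices as colours some number of colours suffices, so the least
    number in \<open>chromatic_number\<close> is attained.\<close>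
  have "proper G S id" using simple_graphD[OF assms(1)] by (auto simp: proper_def)
  then have "colorable (card (id ` S)) (induced G S)" using colorable_card fin assms by blast
  then have c: "colorable (chi G S) (induced G S)"
    unfolding chi_def chromatic_number_def by (rule LeastI)
  show "chi G S \<le> k \<Longrightarrow> colorable k (induced G S)" using colorable_mono[OF c] .
  show "colorable k (induced G S) \<Longrightarrow> chi G S \<le> k"
    unfolding chi_def chromatic_number_def by (rule Least_le)
qed

lemma chi_le_card:
  assumes "simple_graph G" "S \<subseteq> verts G" "proper G S c"
  shows "chi G S \<le> card (c ` S)"
proof -
  have "finite S" using assms(1,2) finite_subset simple_graphD(1) by metis
  then show ?thesis using chi_le_iff[OF assms(1,2)] colorable_card[OF _ assms(2,3)] by simp
qed

text \<open>Colours from a prescribed palette \<open>T\<close>: the bags of a blow-up are coloured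
  from the sets that a packing assigns to them.\<close>

lemma chi_colouring:
  assumes "simple_graph G" "S \<subseteq> verts G" "finite T" "chi G S \<le> card T"
  obtains c where "proper G S c" "c ` S \<subseteq> T"
proof -
  obtain c where c: "c ` S \<subseteq> {..<card T}" "proper G S c"
    using assms chi_le_iff colorable_induced by metis
  obtain h where h: "bij_betw h {0..<card T} T"
    using ex_bij_betw_nat_finite assms(3) by blast
  have "proper G S (h \<circ> c)"
    by (rule proper_comp)
      (use h c in \<open>auto simp: bij_betw_def atLeast0LessThan intro: inj_on_subset\<close>)
  moreover have "(h \<circ> c) ` S \<subseteq> T"
    using h c by (auto simp: bij_betw_def atLeast0LessThan)
  ultimately show ?thesis using that by blast
qed

lemma chi_mono:
  assumes "simple_graph G" "S \<subseteq> verts G" "T \<subseteq> S"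
  shows "chi G T \<le> chi G S"
proof -
  obtain c where c: "proper G S c" "c ` S \<subseteq> {..<chi G S}"
    using chi_colouring[OF assms(1,2), of "{..<chi G S}"] by auto
  have "c ` T \<subseteq> {..<chi G S}" using c assms by auto
  then have "card (c ` T) \<le> chi G S" using card_mono[of "{..<chi G S}"] by fastforce
  moreover have "chi G T \<le> card (c ` T)"
    using chi_le_card[OF assms(1) _ proper_subset[OF c(1) assms(3)]] assms by auto
  ultimately show ?thesis by linarith
qed

lemma chi_empty: "simple_graph G \<Longrightarrow> chi G {} = 0"
  using chi_le_card[of G "{}" id] by (simp add: proper_def)

lemma chi_pos:
  assumes "simple_graph G" "S \<subseteq> verts G" "S \<noteq> {}"
  shows "chi G S \<ge> 1"
proof (rule ccontr)
  assume "\<not> chi G S \<ge> 1"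
  then obtain c :: "_ \<Rightarrow> nat" where "c ` S \<subseteq> {}"
    using chi_colouring[OF assms(1,2), of "{} :: nat set"] by auto
  then show False using assms by auto
qed

text \<open>One fresh colour for \<open>x\<close> extends any colouring of the rest.\<close>

lemma chi_remove:
  assumes "simple_graph G" "S \<subseteq> verts G"
  shows "chi G S \<le> chi G (S - {x}) + 1"
proof -
  let ?n = "chi G (S - {x})"
  obtain c where c: "proper G (S - {x}) c" "c ` (S - {x}) \<subseteq> {..<?n}"
    using chi_colouring[OF assms(1), of "S - {x}" "{..<?n}"] assms by auto
  have "proper G S (c(x := ?n))"
    using c simple_graphD[OF assms(1)] unfolding proper_def image_subset_iff
    by (metis DiffI empty_iff fun_upd_apply insert_iff lessThan_iff less_irrefl)
  moreover have "(c(x := ?n)) ` S \<subseteq> {..<Suc ?n}"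
    using c by (auto simp: image_subset_iff less_Suc_eq)
  ultimately show ?thesis
    using chi_le_iff[OF assms] colorable_induced[OF assms(2)] by (metis Suc_eq_plus1)
qed

lemma induced_verts: "simple_graph G \<Longrightarrow> induced G (verts G) = G"
  by (cases G) (auto simp: induced_def simple_graph_def intro!: ext)

lemma induced_induced: "S \<subseteq> T \<Longrightarrow> induced (induced G T) S = induced G S"
  by (auto simp: induced_def intro!: ext)

lemma critical_induced_iff:
  assumes "simple_graph G" "X \<subseteq> verts G"
  shows "critical k (induced G X) \<longleftrightarrow> chi G X = k \<and> (\<forall>S. S \<subset> X \<longrightarrow> chi G S \<le> k - 1)"
proof -
  have "verts (induced G X) = X" using assms by (auto simp: induced_def)
  moreover have "colorable (k - 1) (induced (induced G X) S) \<longleftrightarrow> chi G S \<le> k - 1"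
    if "S \<subset> X" for S
    using that chi_le_iff[OF assms(1), of S] induced_induced[of S X G] assms by auto
  ultimately show ?thesis unfolding critical_def chi_def[symmetric] by auto
qed

lemma critical_iff:
  assumes "simple_graph G"
  shows "critical k G \<longleftrightarrow> chi G (verts G) = k \<and> (\<forall>S. S \<subset> verts G \<longrightarrow> chi G S \<le> k - 1)"
  using critical_induced_iff[OF assms order_refl] induced_verts[OF assms] by simp


section \<open>Blow-ups\<close>

text \<open>The bags are the fibres of \<open>p\<close>. \<open>R\<close> is consulted only between
  different bags, so it may be reflexive: a join is the case of the constantly true relation on
  \<open>bool\<close>.\<close>

definition blowup :: "'a graph \<Rightarrow> ('a \<Rightarrow> 'i) \<Rightarrow> ('i \<Rightarrow> 'i \<Rightarrow> bool) \<Rightarrow> bool" where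
  "blowup G p R \<longleftrightarrow>
     (\<forall>x\<in>verts G. \<forall>y\<in>verts G. p x \<noteq> p y \<longrightarrow> (adj G x y \<longleftrightarrow> R (p x) (p y)))"

definition bag :: "'a graph \<Rightarrow> ('a \<Rightarrow> 'i) \<Rightarrow> 'i \<Rightarrow> 'a set" where
  "bag G p i = {x \<in> verts G. p x = i}"

text \<open>Colourings with \<open>K\<close> colours of the blow-up of \<open>R\<close> by cliques of sizes \<open>w i\<close>.\<close>

definition packs :: "('i \<Rightarrow> 'i \<Rightarrow> bool) \<Rightarrow> 'i set \<Rightarrow> nat \<Rightarrow> ('i \<Rightarrow> nat) \<Rightarrow> bool" where
  "packs R I K w \<longleftrightarrow> (\<exists>A. (\<forall>i\<in>I. A i \<subseteq> {..<K} \<and> w i \<le> card (A i)) \<and>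
     (\<forall>i\<in>I. \<forall>j\<in>I. i \<noteq> j \<and> R i j \<longrightarrow> A i \<inter> A j = {}))"

lemma packs_antimono: "packs R I K w \<Longrightarrow> (\<And>i. i \<in> I \<Longrightarrow> v i \<le> w i) \<Longrightarrow> packs R I K v"
  unfolding packs_def by (elim ex_forward) (auto intro: le_trans)

lemma bag_subset: "bag G p i \<subseteq> verts G"
  by (auto simp: bag_def)

text \<open>From left to right \<open>A i\<close> collects the colours of bag \<open>i\<close>;
  adjacent bags are completely joined, so they share none. Conversely each bag is coloured from its
  own \<open>A i\<close>. Allowing every \<open>S\<close> turns criticality into a statement about
  weights.\<close>

lemma chi_blowup:
  assumes G: "simple_graph G" and b: "blowup G p R" and I: "p ` verts G \<subseteq> I"
    and S: "S \<subseteq> verts G"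
  shows "chi G S \<le> K \<longleftrightarrow> packs R I K (\<lambda>i. chi G (S \<inter> bag G p i))"
proof
  assume "chi G S \<le> K"
  then obtain c where c: "proper G S c" "c ` S \<subseteq> {..<K}"
    using chi_colouring[OF G S, of "{..<K}"] by auto
  let ?A = "\<lambda>i. c ` (S \<inter> bag G p i)"
  have "?A i \<subseteq> {..<K}" for i using c by auto
  moreover have "chi G (S \<inter> bag G p i) \<le> card (?A i)" for i
    using chi_le_card[OF G _ proper_subset[OF c(1), of "S \<inter> bag G p i"]] S by auto
  moreover have "?A i \<inter> ?A j = {}" if "i \<noteq> j" "R i j" for i j
  proof -
    have "c x \<noteq> c y" if "x \<in> S \<inter> bag G p i" "y \<in> S \<inter> bag G p j" for x y
    proof -
      have xy: "x \<in> verts G" "y \<in> verts G" "p x = i" "p y = j" "x \<in> S" "y \<in> S"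
        using that by (auto simp: bag_def)
      then have "adj G x y" using b \<open>i \<noteq> j\<close> \<open>R i j\<close> by (simp add: blowup_def)
      then show ?thesis using c(1) xy by (simp add: proper_def)
    qed
    then show ?thesis by blast
  qed
  ultimately show "packs R I K (\<lambda>i. chi G (S \<inter> bag G p i))"
    unfolding packs_def by (intro exI[of _ ?A]) simp
next
  assume "packs R I K (\<lambda>i. chi G (S \<inter> bag G p i))"
  then obtain A where "(\<forall>i\<in>I. A i \<subseteq> {..<K} \<and> chi G (S \<inter> bag G p i) \<le> card (A i)) \<and>
     (\<forall>i\<in>I. \<forall>j\<in>I. i \<noteq> j \<and> R i j \<longrightarrow> A i \<inter> A j = {})"
    unfolding packs_def ..
  then have A: "\<And>i. i \<in> I \<Longrightarrow> A i \<subseteq> {..<K}"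
    "\<And>i. i \<in> I \<Longrightarrow> chi G (S \<inter> bag G p i) \<le> card (A i)"
    "\<And>i j. i \<in> I \<Longrightarrow> j \<in> I \<Longrightarrow> i \<noteq> j \<Longrightarrow> R i j \<Longrightarrow> A i \<inter> A j = {}"
    by auto
  have "\<exists>c. proper G (S \<inter> bag G p i) c \<and> c ` (S \<inter> bag G p i) \<subseteq> A i" if "i \<in> I" for i
  proof -
    have "finite (A i)" using A(1)[OF that] finite_subset by blast
    moreover have "S \<inter> bag G p i \<subseteq> verts G" using S by blast
    ultimately show ?thesis using chi_colouring[OF G _ _ A(2)[OF that]] by metis
  qed
  then obtain c where c: "\<And>i. i \<in> I \<Longrightarrow> proper G (S \<inter> bag G p i) (c i)"
    "\<And>i. i \<in> I \<Longrightarrow> c i ` (S \<inter> bag G p i) \<subseteq> A i" by metis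
  let ?f = "\<lambda>x. c (p x) x"
  have mem: "p x \<in> I" "?f x \<in> A (p x)" if "x \<in> S" for x
    using c(2)[of "p x"] that S I by (auto simp: bag_def)
  have "?f x \<noteq> ?f y" if xy: "x \<in> S" "y \<in> S" "adj G x y" for x y
  proof (cases "p x = p y")
    case True
    then show ?thesis using c(1)[of "p x"] mem(1)[OF xy(1)] xy S
      by (auto simp: proper_def bag_def)
  next
    case False
    then have "R (p x) (p y)" using b xy S by (auto simp: blowup_def)
    then show ?thesis using A(3)[OF _ _ False] mem xy by (metis disjoint_iff)
  qed
  then have "proper G S ?f" by (auto simp: proper_def)
  moreover have "?f ` S \<subseteq> {..<K}" using mem A(1) by blast
  ultimately show "chi G S \<le> K" using chi_le_iff[OF G S] colorable_induced[OF S] by blast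
qed

lemma chi_blowup_verts:
  assumes "simple_graph G" "blowup G p R" "p ` verts G \<subseteq> I"
  shows "chi G (verts G) \<le> K \<longleftrightarrow> packs R I K (\<lambda>i. chi G (bag G p i))"
  using chi_blowup[OF assms order_refl] bag_subset[of G p] by (simp add: Int_absorb1)

text \<open>Only the chromatic numbers of the bags matter. A proper subset \<open>S\<close> of a bag
  with the same chromatic number could replace the bag, and the smaller graph would still need k
  colours.\<close>

lemma critical_bag:
  assumes G: "simple_graph G" and b: "blowup G p R" and k: "critical k G" "k \<ge> 1"
  shows "critical (chi G (bag G p i)) (induced G (bag G p i))"
proof -
  have less: "chi G S < chi G (bag G p i)" if S: "S \<subset> bag G p i" for S
  proof (rule ccontr)
    assume n: "\<not> chi G S < chi G (bag G p i)"
    let ?T = "verts G - (bag G p i - S)"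
    have "?T \<subset> verts G" using S bag_subset[of G p i] by blast
    then have "packs R UNIV (k - 1) (\<lambda>j. chi G (?T \<inter> bag G p j))"
      using k(1) chi_blowup[OF G b, of UNIV ?T "k - 1"] by (auto simp: critical_iff[OF G])
    moreover have "chi G (bag G p j) \<le> chi G (?T \<inter> bag G p j)" for j
    proof (cases "j = i")
      case True
      have "?T \<inter> bag G p i = S" using S bag_subset[of G p i] by blast
      then show ?thesis using True n by simp
    next
      case False
      then have "?T \<inter> bag G p j = bag G p j" by (auto simp: bag_def)
      then show ?thesis by simp
    qed
    ultimately have "packs R UNIV (k - 1) (\<lambda>j. chi G (bag G p j))" by (rule packs_antimono)
    then have "chi G (verts G) \<le> k - 1" using chi_blowup_verts[OF G b, of UNIV] by simp
    then show False using k by (auto simp: critical_iff[OF G])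
  qed
  have "chi G S \<le> chi G (bag G p i) - 1" if "S \<subset> bag G p i" for S
    using less[OF that] by linarith
  then show ?thesis by (simp add: critical_induced_iff[OF G bag_subset])
qed

text \<open>Deleting one vertex of bag \<open>i\<close> lowers its weight by at most one and leaves
  the other weights alone. The k - 1 colours of the smaller graph thus yield inequalities on the
  weights.\<close>

lemma critical_packs_remove:
  assumes G: "simple_graph G" and b: "blowup G p R" and I: "p ` verts G = I"
    and k: "critical k G" and i: "i \<in> I"
  shows "packs R I (k - 1) ((\<lambda>j. chi G (bag G p j)) (i := chi G (bag G p i) - 1))"
proof -
  obtain x where x: "x \<in> verts G" "p x = i" using i I by auto
  let ?T = "verts G - {x}"
  have "chi G ?T \<le> k - 1" using k x(1) by (auto simp: critical_iff[OF G])
  then have "packs R I (k - 1) (\<lambda>j. chi G (?T \<inter> bag G p j))"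
    using chi_blowup[OF G b, of I ?T "k - 1"] I by auto
  then show ?thesis
  proof (rule packs_antimono)
    fix j
    show "((\<lambda>j. chi G (bag G p j)) (i := chi G (bag G p i) - 1)) j \<le> chi G (?T \<inter> bag G p j)"
    proof (cases "j = i")
      case True
      have "?T \<inter> bag G p i = bag G p i - {x}" by (auto simp: bag_def)
      then show ?thesis using True chi_remove[OF G bag_subset, of p i x] by simp
    next
      case False
      then have "?T \<inter> bag G p j = bag G p j" using x by (auto simp: bag_def)
      then show ?thesis using False by simp
    qed
  qed
qed

text \<open>A proper subset misses a vertex of some bag. As that bag is critical, its weight drops
  by at least one, so it is enough to test the weights lowered at one place.\<close>

lemma critical_blowupI:
  assumes G: "simple_graph G" and b: "blowup G p R" and I: "p ` verts G \<subseteq> I"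
    and w: "\<And>i. i \<in> I \<Longrightarrow> critical (w i) (induced G (bag G p i))"
    and k: "packs R I k w" "\<not> packs R I (k - 1) w" "k \<ge> 1"
    and rem: "\<And>i. i \<in> I \<Longrightarrow> packs R I (k - 1) (w (i := w i - 1))"
  shows "critical k G"
proof -
  have wi: "chi G (bag G p i) = w i" "S \<subset> bag G p i \<Longrightarrow> chi G S \<le> w i - 1" if "i \<in> I" for i S
    using w[OF that] by (simp_all add: critical_induced_iff[OF G bag_subset])
  have pk: "packs R I K (\<lambda>i. chi G (bag G p i)) \<longleftrightarrow> packs R I K w" for K
    by (intro iffI; erule packs_antimono; simp add: wi(1))
  have "chi G (verts G) = k"
    using chi_blowup_verts[OF G b I, of k] chi_blowup_verts[OF G b I, of "k - 1"] k pk by auto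
  moreover have "chi G S \<le> k - 1" if S: "S \<subset> verts G" for S
  proof -
    obtain x where x: "x \<in> verts G" "x \<notin> S" using S by auto
    let ?i = "p x"
    have "?i \<in> I" using I x by auto
    have "packs R I (k - 1) (\<lambda>j. chi G (S \<inter> bag G p j))"
      using rem[OF \<open>?i \<in> I\<close>]
    proof (rule packs_antimono)
      fix j assume j: "j \<in> I"
      show "chi G (S \<inter> bag G p j) \<le> (w (?i := w ?i - 1)) j"
      proof (cases "j = ?i")
        case True
        have "S \<inter> bag G p ?i \<subset> bag G p ?i" using x by (auto simp: bag_def)
        then show ?thesis using True wi(2)[OF j] by simp
      next
        case False
        then show ?thesis using wi(1)[OF j] chi_mono[OF G bag_subset, of "S \<inter> bag G p j" p j]
          by simp
      qed
    qed
    then show ?thesis using chi_blowup[OF G b I, of S "k - 1"] S by auto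
  qed
  ultimately show ?thesis using critical_iff[OF G] by auto
qed

section \<open>Packings for joins and for the 5-cycle\<close>

definition C5 :: "nat \<Rightarrow> nat \<Rightarrow> bool" where
  "C5 i j \<longleftrightarrow> j = (i + 1) mod 5 \<or> i = (j + 1) mod 5"

lemma lessThan_5: "{..<5::nat} = {0, 1, 2, 3, 4}"
  by (simp add: eval_nat_numeral lessThan_Suc insert_commute)

lemma all_less_5: "(\<forall>i<5::nat. P i) \<longleftrightarrow> P 0 \<and> P 1 \<and> P 2 \<and> P 3 \<and> P 4"
  using lessThan_5 by (metis (no_types, lifting) empty_iff insert_iff lessThan_iff)

lemma packs_join:
  "packs (\<lambda>_ _. True) (UNIV :: bool set) K w \<longleftrightarrow> w False + w True \<le> K"
proof
  assume "packs (\<lambda>_ _. True) (UNIV :: bool set) K w"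
  then obtain A where A: "(\<forall>i\<in>UNIV. A i \<subseteq> {..<K} \<and> w i \<le> card (A i)) \<and>
     (\<forall>i\<in>(UNIV :: bool set). \<forall>j\<in>UNIV. i \<noteq> j \<and> True \<longrightarrow> A i \<inter> A j = {})"
    unfolding packs_def ..
  then have "w False + w True \<le> card (A False) + card (A True)" by (simp add: add_mono)
  also have "\<dots> = card (A False \<union> A True)"
  proof (rule card_Un_disjoint[symmetric])
    show "A False \<inter> A True = {}" using A by blast
  qed (use A finite_subset[of _ "{..<K}"] in auto)
  also have "\<dots> \<le> K" using A card_mono[of "{..<K}" "A False \<union> A True"] by simp
  finally show "w False + w True \<le> K" .
next
  assume "w False + w True \<le> K"
  then show "packs (\<lambda>_ _. True) (UNIV :: bool set) K w" unfolding packs_def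
    by (intro exI[of _ "\<lambda>b. if b then {w False..<w False + w True} else {..<w False}"]) auto
qed

text \<open>With total exactly \<open>2 * K\<close> the sizes of the colour sets in
  \<open>C5_weights_sets\<close> are determined by linear equations. The induction is on the missing
  amount and raises one weight at a time.\<close>

lemma C5_weights_pad:
  fixes a0 a1 a2 a3 a4 K :: nat
  assumes "a0 + a1 \<le> K" "a1 + a2 \<le> K" "a2 + a3 \<le> K" "a3 + a4 \<le> K" "a4 + a0 \<le> K"
    and "a0 + a1 + a2 + a3 + a4 \<le> 2 * K"
  shows "\<exists>b0 b1 b2 b3 b4. a0 \<le> b0 \<and> a1 \<le> b1 \<and> a2 \<le> b2 \<and> a3 \<le> b3 \<and> a4 \<le> b4 \<and>
     b0 + b1 \<le> K \<and> b1 + b2 \<le> K \<and> b2 + b3 \<le> K \<and> b3 + b4 \<le> K \<and> b4 + b0 \<le> K \<and>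
     b0 + b1 + b2 + b3 + b4 = 2 * K" (is "?P a0 a1 a2 a3 a4")
  using assms
proof (induction "2 * K - (a0 + a1 + a2 + a3 + a4)" arbitrary: a0 a1 a2 a3 a4)
  case 0
  then show ?case by (intro exI[of _ a0] exI[of _ a1] exI[of _ a2] exI[of _ a3] exI[of _ a4]) simp
next
  case (Suc n)
  have mono: "?P c0 c1 c2 c3 c4 \<Longrightarrow> a0 \<le> c0 \<Longrightarrow> a1 \<le> c1 \<Longrightarrow> a2 \<le> c2 \<Longrightarrow> a3 \<le> c3 \<Longrightarrow> a4 \<le> c4 \<Longrightarrow>
    ?P a0 a1 a2 a3 a4" for c0 c1 c2 c3 c4
    by (elim ex_forward) simp
  \<comment> \<open>Two disjoint tight edges would already give the full sum, so some vertex has none.\<close>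
  have "(a4 + a0 < K \<and> a0 + a1 < K) \<or> (a0 + a1 < K \<and> a1 + a2 < K) \<or> (a1 + a2 < K \<and> a2 + a3 < K) \<or>
    (a2 + a3 < K \<and> a3 + a4 < K) \<or> (a3 + a4 < K \<and> a4 + a0 < K)"
    using Suc.hyps(2) Suc.prems by arith
  then show ?case
  proof (elim disjE)
    assume "a4 + a0 < K \<and> a0 + a1 < K"
    then have "?P (Suc a0) a1 a2 a3 a4"
      using Suc.hyps(2) Suc.prems by (intro Suc.hyps(1)) linarith+
    then show ?thesis by (rule mono) simp_all
  next
    assume "a0 + a1 < K \<and> a1 + a2 < K"
    then have "?P a0 (Suc a1) a2 a3 a4"
      using Suc.hyps(2) Suc.prems by (intro Suc.hyps(1)) linarith+
    then show ?thesis by (rule mono) simp_all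
  next
    assume "a1 + a2 < K \<and> a2 + a3 < K"
    then have "?P a0 a1 (Suc a2) a3 a4"
      using Suc.hyps(2) Suc.prems by (intro Suc.hyps(1)) linarith+
    then show ?thesis by (rule mono) simp_all
  next
    assume "a2 + a3 < K \<and> a3 + a4 < K"
    then have "?P a0 a1 a2 (Suc a3) a4"
      using Suc.hyps(2) Suc.prems by (intro Suc.hyps(1)) linarith+
    then show ?thesis by (rule mono) simp_all
  next
    assume "a3 + a4 < K \<and> a4 + a0 < K"
    then have "?P a0 a1 a2 a3 (Suc a4)"
      using Suc.hyps(2) Suc.prems by (intro Suc.hyps(1)) linarith+
    then show ?thesis by (rule mono) simp_all
  qed
qed

text \<open>When the weights sum to \<open>2 * K\<close>, every colour is used on exactly two non-consecutive bags.
  The number of colours shared by the two neighbours of bag \<open>i\<close> must then be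
  \<open>K - a (i + 2) - a (i + 3)\<close>.\<close>

lemma C5_weights_sets:
  fixes a0 a1 a2 a3 a4 K :: nat
  assumes "a0 + a1 \<le> K" "a1 + a2 \<le> K" "a2 + a3 \<le> K" "a3 + a4 \<le> K" "a4 + a0 \<le> K"
    and "a0 + a1 + a2 + a3 + a4 = 2 * K"
  obtains A0 A1 A2 A3 A4 where
    "A0 \<subseteq> {..<K}" "A1 \<subseteq> {..<K}" "A2 \<subseteq> {..<K}" "A3 \<subseteq> {..<K}" "A4 \<subseteq> {..<K}"
    "card A0 = a0" "card A1 = a1" "card A2 = a2" "card A3 = a3" "card A4 = a4"
    "A0 \<inter> A1 = {}" "A1 \<inter> A2 = {}" "A2 \<inter> A3 = {}" "A3 \<inter> A4 = {}" "A4 \<inter> A0 = {}"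
proof -
  define n0 where "n0 = K - a2 - a3"
  define n1 where "n1 = K - a3 - a4"
  define n2 where "n2 = K - a4 - a0"
  define n3 where "n3 = K - a0 - a1"
  define n4 where "n4 = K - a1 - a2"
  have e: "n0 + a2 + a3 = K" "n1 + a3 + a4 = K" "n2 + a4 + a0 = K" "n3 + a0 + a1 = K" "n4 + a1 + a2 = K"
    subgoal using assms(3) by (simp add: n0_def)
    subgoal using assms(4) by (simp add: n1_def)
    subgoal using assms(5) by (simp add: n2_def)
    subgoal using assms(1) by (simp add: n3_def)
    subgoal using assms(2) by (simp add: n4_def)
    done
  have s: "n0 + n1 + n2 + n3 + n4 = K" "n4 + n1 = a0" "n0 + n2 = a1" "n1 + n3 = a2"
    "n2 + n4 = a3" "n3 + n0 = a4"
    using assms e by linarith+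
  \<comment> \<open>The numbers \<open>n0\<close> to \<open>n4\<close> add up to \<open>K\<close>,
    so consecutive intervals of these lengths partition the colours. Those in \<open>I0\<close> go
    to bags 1 and 4, the neighbours of bag 0, and so on cyclically.\<close>
  define I0 where "I0 = {..<n0}"
  define I1 where "I1 = {n0..<n0 + n1}"
  define I2 where "I2 = {n0 + n1..<n0 + n1 + n2}"
  define I3 where "I3 = {n0 + n1 + n2..<n0 + n1 + n2 + n3}"
  define I4 where "I4 = {n0 + n1 + n2 + n3..<K}"
  note I = I0_def I1_def I2_def I3_def I4_def
  have fin: "finite I0" "finite I1" "finite I2" "finite I3" "finite I4" by (simp_all add: I)
  have disj: "I0 \<inter> I1 = {}" "I0 \<inter> I2 = {}" "I0 \<inter> I3 = {}" "I0 \<inter> I4 = {}" "I1 \<inter> I2 = {}"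
    "I1 \<inter> I3 = {}" "I1 \<inter> I4 = {}" "I2 \<inter> I3 = {}" "I2 \<inter> I4 = {}" "I3 \<inter> I4 = {}"
    unfolding I by auto
  have sub: "I0 \<subseteq> {..<K}" "I1 \<subseteq> {..<K}" "I2 \<subseteq> {..<K}" "I3 \<subseteq> {..<K}" "I4 \<subseteq> {..<K}"
    unfolding I s(1)[symmetric] by auto
  have c: "card I0 = n0" "card I1 = n1" "card I2 = n2" "card I3 = n3" "card I4 = n4"
    using s(1) by (simp_all add: I)
  show thesis
  proof (rule that[of "I4 \<union> I1" "I0 \<union> I2" "I1 \<union> I3" "I2 \<union> I4" "I3 \<union> I0"])
    show "card (I4 \<union> I1) = a0" "card (I0 \<union> I2) = a1" "card (I1 \<union> I3) = a2" "card (I2 \<union> I4) = a3"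
      "card (I3 \<union> I0) = a4"
      using disj c s fin by (simp_all add: card_Un_disjoint Int_commute)
  qed (use sub disj in \<open>simp_all add: Int_Un_distrib Int_Un_distrib2 Int_commute\<close>)
qed

text \<open>The total is bounded because no colour lies in three of the sets: among any three bags
  two are consecutive. For sufficiency, pad the weights and partition the colours.\<close>

lemma packs_C5:
  "packs C5 {..<5} K w \<longleftrightarrow> (\<forall>i<5. w i + w ((i + 1) mod 5) \<le> K) \<and> (\<Sum>i<5. w i) \<le> 2 * K"
proof
  assume "packs C5 {..<5} K w"
  then obtain A where "(\<forall>i\<in>{..<5}. A i \<subseteq> {..<K} \<and> w i \<le> card (A i)) \<and>
     (\<forall>i\<in>{..<5}. \<forall>j\<in>{..<5}. i \<noteq> j \<and> C5 i j \<longrightarrow> A i \<inter> A j = {})"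
    unfolding packs_def ..
  then have A: "\<And>i. i < 5 \<Longrightarrow> A i \<subseteq> {..<K}" "\<And>i. i < 5 \<Longrightarrow> w i \<le> card (A i)"
    "\<And>i j. i < 5 \<Longrightarrow> j < 5 \<Longrightarrow> i \<noteq> j \<Longrightarrow> C5 i j \<Longrightarrow> A i \<inter> A j = {}"
    by auto
  have fin: "finite (A i)" if "i < 5" for i using A(1)[OF that] finite_subset by blast
  have d: "A i \<inter> A ((i + 1) mod 5) = {}" if "i < 5" for i
  proof (rule A(3))
    show "i \<noteq> (i + 1) mod 5" using that by (cases "i = 4") auto
  qed (use that in \<open>auto simp: C5_def\<close>)
  have "w i + w ((i + 1) mod 5) \<le> K" if i: "i < 5" for i
  proof -
    have "w i + w ((i + 1) mod 5) \<le> card (A i) + card (A ((i + 1) mod 5))"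
      using A(2) i by (simp add: add_mono)
    also have "\<dots> = card (A i \<union> A ((i + 1) mod 5))"
      using fin d i by (intro card_Un_disjoint[symmetric]) auto
    also have "\<dots> \<le> K"
      using A(1)[OF i] A(1)[of "(i + 1) mod 5"] card_mono[of "{..<K}" "A i \<union> A ((i + 1) mod 5)"]
      by simp
    finally show ?thesis .
  qed
  moreover have "(\<Sum>i<5. w i) \<le> 2 * K"
  proof -
    have "(\<Sum>i<5. w i) \<le> (\<Sum>i<5. card (A i))" using A(2) by (intro sum_mono) simp
    \<comment> \<open>Double counting of the pairs of a bag and a colour assigned to it.\<close>
    also have "\<dots> = (\<Sum>i<5. \<Sum>c<K. of_bool (c \<in> A i))"
      using A(1) by (intro sum.cong) (simp_all add: of_bool_def sum.If_cases Int_absorb1 Collect_mem_eq)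
    also have "\<dots> = (\<Sum>c<K. \<Sum>i<5. of_bool (c \<in> A i))" by (rule sum.swap)
    also have "\<dots> \<le> (\<Sum>c<K. 2)"
    proof (rule sum_mono)
      fix c
      have "A 0 \<inter> A 1 = {}" "A 1 \<inter> A 2 = {}" "A 2 \<inter> A 3 = {}" "A 3 \<inter> A 4 = {}" "A 4 \<inter> A 0 = {}"
        using d[of 0] d[of 1] d[of 2] d[of 3] d[of 4] by (simp_all add: numeral_2_eq_2)
      then have "\<not> (c \<in> A 0 \<and> c \<in> A 1)" "\<not> (c \<in> A 1 \<and> c \<in> A 2)" "\<not> (c \<in> A 2 \<and> c \<in> A 3)"
        "\<not> (c \<in> A 3 \<and> c \<in> A 4)" "\<not> (c \<in> A 4 \<and> c \<in> A 0)"
        unfolding disjoint_iff by metis+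
      then show "(\<Sum>i<5. of_bool (c \<in> A i)) \<le> (2 :: nat)"
        unfolding lessThan_5
        by (cases "c \<in> A 0"; cases "c \<in> A 1"; cases "c \<in> A 2"; cases "c \<in> A 3"; cases "c \<in> A 4"; simp)
    qed
    finally show ?thesis by simp
  qed
  ultimately show "(\<forall>i<5. w i + w ((i + 1) mod 5) \<le> K) \<and> (\<Sum>i<5. w i) \<le> 2 * K" by blast
next
  assume "(\<forall>i<5. w i + w ((i + 1) mod 5) \<le> K) \<and> (\<Sum>i<5. w i) \<le> 2 * K"
  then have "w 0 + w 1 \<le> K" "w 1 + w 2 \<le> K" "w 2 + w 3 \<le> K" "w 3 + w 4 \<le> K" "w 4 + w 0 \<le> K"
    "w 0 + w 1 + w 2 + w 3 + w 4 \<le> 2 * K"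
    unfolding all_less_5 lessThan_5 by (simp_all add: numeral_2_eq_2)
  from C5_weights_pad[OF this] obtain b0 b1 b2 b3 b4 where b:
    "w 0 \<le> b0 \<and> w 1 \<le> b1 \<and> w 2 \<le> b2 \<and> w 3 \<le> b3 \<and> w 4 \<le> b4 \<and>
     b0 + b1 \<le> K \<and> b1 + b2 \<le> K \<and> b2 + b3 \<le> K \<and> b3 + b4 \<le> K \<and> b4 + b0 \<le> K \<and>
     b0 + b1 + b2 + b3 + b4 = 2 * K"
    by (elim exE)
  then have "b0 + b1 \<le> K" "b1 + b2 \<le> K" "b2 + b3 \<le> K" "b3 + b4 \<le> K" "b4 + b0 \<le> K"
    "b0 + b1 + b2 + b3 + b4 = 2 * K" by simp_all
  then obtain A0 A1 A2 A3 A4 where A: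
    "A0 \<subseteq> {..<K}" "A1 \<subseteq> {..<K}" "A2 \<subseteq> {..<K}" "A3 \<subseteq> {..<K}" "A4 \<subseteq> {..<K}"
    "card A0 = b0" "card A1 = b1" "card A2 = b2" "card A3 = b3" "card A4 = b4"
    "A0 \<inter> A1 = {}" "A1 \<inter> A2 = {}" "A2 \<inter> A3 = {}" "A3 \<inter> A4 = {}" "A4 \<inter> A0 = {}"
    by (rule C5_weights_sets)
  let ?A = "\<lambda>i. [A0, A1, A2, A3, A4] ! i"
  show "packs C5 {..<5} K w"
    unfolding packs_def lessThan_5
    by (intro exI[of _ ?A]) (use A b in \<open>simp add: C5_def Int_commute\<close>)
qed


section \<open>Induced paths and houses\<close>

definition ind_P5 :: "'a graph \<Rightarrow> 'a \<Rightarrow> 'a \<Rightarrow> 'a \<Rightarrow> 'a \<Rightarrow> 'a \<Rightarrow> bool" where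
  "ind_P5 G a b c d e \<longleftrightarrow> adj G a b \<and> adj G b c \<and> adj G c d \<and> adj G d e \<and>
     \<not> adj G a c \<and> \<not> adj G a d \<and> \<not> adj G a e \<and> \<not> adj G b d \<and> \<not> adj G b e \<and> \<not> adj G c e"

text \<open>Here \<open>a, b, c, d, e\<close> is the path in the complement.\<close>

definition ind_house :: "'a graph \<Rightarrow> 'a \<Rightarrow> 'a \<Rightarrow> 'a \<Rightarrow> 'a \<Rightarrow> 'a \<Rightarrow> bool" where
  "ind_house G a b c d e \<longleftrightarrow> \<not> adj G a b \<and> \<not> adj G b c \<and> \<not> adj G c d \<and> \<not> adj G d e \<and>
     adj G a c \<and> adj G a d \<and> adj G a e \<and> adj G b d \<and> adj G b e \<and> adj G c e"

text \<open>Induced copies become injections out of \<open>H\<close>, whose values can then be named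
  as vertices.\<close>

lemma free_of_iff_embedding:
  assumes "simple_graph G"
  shows "free_of H G \<longleftrightarrow> \<not> (\<exists>g. inj_on g (verts H) \<and> g ` verts H \<subseteq> verts G \<and>
    (\<forall>i\<in>verts H. \<forall>j\<in>verts H. adj H i j \<longleftrightarrow> adj G (g i) (g j)))"
proof -
  have "(\<exists>S\<subseteq>verts G. graph_iso (induced G S) H) \<longleftrightarrow> (\<exists>g. inj_on g (verts H) \<and> g ` verts H \<subseteq> verts G \<and>
    (\<forall>i\<in>verts H. \<forall>j\<in>verts H. adj H i j \<longleftrightarrow> adj G (g i) (g j)))" (is "?L \<longleftrightarrow> ?R")
  proof
    assume ?L
    then obtain S f where S: "S \<subseteq> verts G" and f: "bij_betw f S (verts H)"
      "\<forall>x\<in>S. \<forall>y\<in>S. adj G x y \<longleftrightarrow> adj H (f x) (f y)"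
      unfolding graph_iso_def induced_def by (auto simp: Int_absorb1)
    let ?g = "inv_into S f"
    have g: "bij_betw ?g (verts H) S" using f(1) by (rule bij_betw_inv_into)
    have "?g i \<in> S \<and> f (?g i) = i" if "i \<in> verts H" for i
      using that f(1) by (metis bij_betw_def f_inv_into_f inv_into_into)
    then have "\<forall>i\<in>verts H. \<forall>j\<in>verts H. adj H i j \<longleftrightarrow> adj G (?g i) (?g j)" using f(2) by metis
    then show ?R using g S by (auto simp: bij_betw_def intro!: exI[of _ ?g])
  next
    assume ?R
    then obtain g where g: "inj_on g (verts H)" "g ` verts H \<subseteq> verts G"
      "\<forall>i\<in>verts H. \<forall>j\<in>verts H. adj H i j \<longleftrightarrow> adj G (g i) (g j)" by blast
    let ?S = "g ` verts H" and ?f = "inv_into (verts H) g"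
    have "bij_betw ?f ?S (verts H)" using g(1) by (simp add: bij_betw_inv_into inj_on_imp_bij_betw)
    moreover have "\<forall>x\<in>?S. \<forall>y\<in>?S. adj G x y \<longleftrightarrow> adj H (?f x) (?f y)" using g by auto
    ultimately have "graph_iso (induced G ?S) H"
      using g(2) unfolding graph_iso_def induced_def by (auto simp: Int_absorb1 intro!: exI[of _ ?f])
    then show ?L using g(2) by blast
  qed
  then show ?thesis by (simp add: free_of_def)
qed

text \<open>The last assumption lets the adjacency pattern alone supply injectivity and membership
  in the graph.\<close>

lemma embedding_5_iff:
  assumes "verts H = {..<5 :: nat}"
    and "\<And>g :: nat \<Rightarrow> 'a. (\<forall>i<5. \<forall>j<5. adj H i j \<longleftrightarrow> adj G (g i) (g j)) \<longleftrightarrow> Q (g 0) (g 1) (g 2) (g 3) (g 4)"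
    and "\<And>a b c d e. Q a b c d e \<Longrightarrow> distinct [a, b, c, d, e] \<and> {a, b, c, d, e} \<subseteq> verts G"
  shows "(\<exists>g. inj_on g (verts H) \<and> g ` verts H \<subseteq> verts G \<and>
    (\<forall>i\<in>verts H. \<forall>j\<in>verts H. adj H i j \<longleftrightarrow> adj G (g i) (g j))) \<longleftrightarrow> (\<exists>a b c d e. Q a b c d e)"
proof
  assume "\<exists>a b c d e. Q a b c d e"
  then obtain a b c d e where q: "Q a b c d e" by blast
  let ?g = "\<lambda>i. [a, b, c, d, e] ! i"
  have "inj_on ?g {..<5}" using assms(3)[OF q] by (intro inj_on_nth) auto
  moreover have "?g ` {..<5} \<subseteq> verts G" using assms(3)[OF q] by (auto simp: lessThan_5)
  moreover have "\<forall>i<5. \<forall>j<5. adj H i j \<longleftrightarrow> adj G (?g i) (?g j)"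
    unfolding assms(2) using q by simp
  ultimately show "\<exists>g. inj_on g (verts H) \<and> g ` verts H \<subseteq> verts G \<and>
    (\<forall>i\<in>verts H. \<forall>j\<in>verts H. adj H i j \<longleftrightarrow> adj G (g i) (g j))"
    using assms(1) by (intro exI[of _ ?g]) simp
next
  assume "\<exists>g. inj_on g (verts H) \<and> g ` verts H \<subseteq> verts G \<and>
    (\<forall>i\<in>verts H. \<forall>j\<in>verts H. adj H i j \<longleftrightarrow> adj G (g i) (g j))"
  then obtain g where "\<forall>i<5. \<forall>j<5. adj H i j \<longleftrightarrow> adj G (g i) (g j)"
    unfolding assms(1) by auto
  then have "Q (g 0) (g 1) (g 2) (g 3) (g 4)" by (rule assms(2)[THEN iffD1])
  then show "\<exists>a b c d e. Q a b c d e" by blast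
qed

text \<open>The five vertices of the pattern have pairwise different neighbours, so two equal ones
  would be both adjacent and nonadjacent to some vertex. The same holds for the house, which is why
  neither predicate demands distinctness.\<close>

lemma ind_P5_distinct:
  assumes "simple_graph G" "ind_P5 G a b c d e"
  shows "distinct [a, b, c, d, e] \<and> {a, b, c, d, e} \<subseteq> verts G"
proof -
  have "distinct [a, b, c, d, e]" using assms(2) simple_graphD(4,5)[OF assms(1)]
    unfolding ind_P5_def by (simp; metis)
  then show ?thesis using assms(2) simple_graphD(2,3)[OF assms(1)] by (auto simp: ind_P5_def)
qed

lemma ind_house_distinct:
  assumes "simple_graph G" "ind_house G a b c d e"
  shows "distinct [a, b, c, d, e] \<and> {a, b, c, d, e} \<subseteq> verts G"
proof -
  have "distinct [a, b, c, d, e]" using assms(2) simple_graphD(4,5)[OF assms(1)]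
    unfolding ind_house_def by (simp; metis)
  then show ?thesis using assms(2) simple_graphD(2,3)[OF assms(1)] by (auto simp: ind_house_def)
qed

lemma P5_coP5_free_iff:
  assumes G: "simple_graph G"
  shows "P5_coP5_free G \<longleftrightarrow>
    (\<forall>a b c d e. \<not> ind_P5 G a b c d e) \<and> (\<forall>a b c d e. \<not> ind_house G a b c d e)"
proof -
  note sym = simple_graphD(4)[OF G] and irrefl = simple_graphD(5)[OF G]
  have "free_of (path_graph 5) G \<longleftrightarrow> \<not> (\<exists>a b c d e. ind_P5 G a b c d e)"
    unfolding free_of_iff_embedding[OF G] not_not
  proof (rule arg_cong[where f = Not], rule embedding_5_iff[OF _ _ ind_P5_distinct[OF G]])
    show "verts (path_graph 5) = {..<5}" by (simp add: path_graph_def)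
    show "(\<forall>i<5. \<forall>j<5. adj (path_graph 5) i j \<longleftrightarrow> adj G (g i) (g j)) \<longleftrightarrow>
      ind_P5 G (g 0) (g 1) (g 2) (g 3) (g 4)" for g
      using irrefl sym[of "g 1" "g 0"] sym[of "g 2" "g 0"] sym[of "g 2" "g 1"] sym[of "g 3" "g 0"]
        sym[of "g 3" "g 1"] sym[of "g 3" "g 2"] sym[of "g 4" "g 0"] sym[of "g 4" "g 1"]
        sym[of "g 4" "g 2"] sym[of "g 4" "g 3"]
      by (auto simp: path_graph_def all_less_5 ind_P5_def)
  qed
  moreover have "free_of (complement (path_graph 5)) G \<longleftrightarrow> \<not> (\<exists>a b c d e. ind_house G a b c d e)"
    unfolding free_of_iff_embedding[OF G] not_not
  proof (rule arg_cong[where f = Not], rule embedding_5_iff[OF _ _ ind_house_distinct[OF G]])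
    show "verts (complement (path_graph 5)) = {..<5}"
      by (simp add: path_graph_def complement_def)
    show "(\<forall>i<5. \<forall>j<5. adj (complement (path_graph 5)) i j \<longleftrightarrow> adj G (g i) (g j)) \<longleftrightarrow>
      ind_house G (g 0) (g 1) (g 2) (g 3) (g 4)" for g
      using irrefl sym[of "g 1" "g 0"] sym[of "g 2" "g 0"] sym[of "g 2" "g 1"] sym[of "g 3" "g 0"]
        sym[of "g 3" "g 1"] sym[of "g 3" "g 2"] sym[of "g 4" "g 0"] sym[of "g 4" "g 1"]
        sym[of "g 4" "g 2"] sym[of "g 4" "g 3"]
      by (auto simp: complement_def path_graph_def all_less_5 ind_house_def)
  qed
  ultimately show ?thesis by (auto simp: P5_coP5_free_def)
qed


section \<open>Joins and buoys of critical graphs\<close>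

text \<open>Bags of \<open>graph_join\<close> and \<open>substitute\<close> live on another type
  than the graphs they copy. Chromatic number, criticality and freeness are carried over along such
  maps.\<close>

definition embeds :: "('a \<Rightarrow> 'b) \<Rightarrow> 'a graph \<Rightarrow> 'b graph \<Rightarrow> bool" where
  "embeds f G H \<longleftrightarrow> inj_on f (verts G) \<and> f ` verts G \<subseteq> verts H \<and>
     (\<forall>x\<in>verts G. \<forall>y\<in>verts G. adj G x y \<longleftrightarrow> adj H (f x) (f y))"

lemma verts_induced: "S \<subseteq> verts G \<Longrightarrow> verts (induced G S) = S"
  by (auto simp: induced_def)

lemma adj_induced: "adj (induced G S) x y \<longleftrightarrow> adj G x y \<and> x \<in> S \<and> y \<in> S"
  by (simp add: induced_def)

lemma chi_embeds:
  assumes G: "simple_graph G" and H: "simple_graph H" and f: "embeds f G H" and S: "S \<subseteq> verts G"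
  shows "chi H (f ` S) = chi G S"
proof (rule antisym)
  have fS: "f ` S \<subseteq> verts H" using f S by (auto simp: embeds_def)
  have a: "adj G x y \<longleftrightarrow> adj H (f x) (f y)" if "x \<in> S" "y \<in> S" for x y
    using f S that by (auto simp: embeds_def)
  have inj: "inj_on f S" using f S inj_on_subset by (auto simp: embeds_def)
  obtain c where c: "proper G S c" "c ` S \<subseteq> {..<chi G S}"
    using chi_colouring[OF G S, of "{..<chi G S}"] by auto
  have "proper H (f ` S) (c \<circ> inv_into S f)"
    using c(1) a by (simp add: proper_def inv_into_f_f[OF inj])
  moreover have "(c \<circ> inv_into S f) ` f ` S = c ` S"
    by (simp add: image_image inv_into_f_f[OF inj])
  ultimately show "chi H (f ` S) \<le> chi G S"
    using c(2) chi_le_iff[OF H fS] colorable_induced[OF fS] by metis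
  obtain d where d: "proper H (f ` S) d" "d ` f ` S \<subseteq> {..<chi H (f ` S)}"
    using chi_colouring[OF H fS, of "{..<chi H (f ` S)}"] by auto
  have "proper G S (d \<circ> f)" using d(1) a by (simp add: proper_def)
  then show "chi G S \<le> chi H (f ` S)"
    using d(2) chi_le_iff[OF G S] colorable_induced[OF S] by (metis image_comp)
qed

lemma critical_embeds:
  assumes G: "simple_graph G" and H: "simple_graph H" and f: "embeds f G H"
  shows "critical m (induced H (f ` verts G)) \<longleftrightarrow> critical m G"
proof -
  let ?X = "f ` verts G"
  have X: "?X \<subseteq> verts H" using f by (auto simp: embeds_def)
  have inj: "inj_on f (verts G)" using f by (simp add: embeds_def)
  have "(\<forall>S. S \<subset> ?X \<longrightarrow> chi H S \<le> m - 1) \<longleftrightarrow> (\<forall>S. S \<subset> verts G \<longrightarrow> chi G S \<le> m - 1)"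
  proof (intro iffI allI impI)
    fix S assume h: "\<forall>S. S \<subset> ?X \<longrightarrow> chi H S \<le> m - 1" and S: "S \<subset> verts G"
    have "f ` S \<subset> ?X" using inj S by (simp add: image_strict_mono)
    then have "chi H (f ` S) \<le> m - 1" using h by simp
    then show "chi G S \<le> m - 1" using chi_embeds[OF G H f] S by auto
  next
    fix S assume h: "\<forall>S. S \<subset> verts G \<longrightarrow> chi G S \<le> m - 1" and S: "S \<subset> ?X"
    then obtain T where T: "T \<subseteq> verts G" "S = f ` T" using subset_imageE by (metis psubset_imp_subset)
    then have "T \<noteq> verts G" using S by blast
    then have "chi G T \<le> m - 1" using h T by blast
    then show "chi H S \<le> m - 1" using chi_embeds[OF G H f T(1)] T(2) by simp
  qed
  then show ?thesis
    unfolding critical_induced_iff[OF H X] critical_iff[OF G] using chi_embeds[OF G H f order_refl]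
    by simp
qed

lemma ind_P5_embeds:
  assumes "\<forall>x\<in>{a, b, c, d, e}. \<forall>y\<in>{a, b, c, d, e}. adj G x y \<longleftrightarrow> adj H (f x) (f y)"
  shows "ind_P5 G a b c d e \<longleftrightarrow> ind_P5 H (f a) (f b) (f c) (f d) (f e)"
    and "ind_house G a b c d e \<longleftrightarrow> ind_house H (f a) (f b) (f c) (f d) (f e)"
  using assms by (simp_all add: ind_P5_def ind_house_def)

lemma free_embeds:
  assumes G: "simple_graph G" and H: "simple_graph H" and f: "embeds f G H" and X: "f ` verts G = X"
  shows "P5_coP5_free (induced H X) \<longleftrightarrow> P5_coP5_free G"
proof -
  let ?K = "induced H X"
  have K: "simple_graph ?K" using H by (rule simple_graph_induced)
  have vK: "verts ?K = X" using f X by (auto simp: embeds_def induced_def)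
  have a: "adj G x y \<longleftrightarrow> adj ?K (f x) (f y)" if "x \<in> verts G" "y \<in> verts G" for x y
    using f that X by (auto simp: embeds_def adj_induced)
  have "(\<exists>a b c d e. ind_P5 G a b c d e) \<longleftrightarrow> (\<exists>a b c d e. ind_P5 ?K a b c d e)"
  proof
    assume "\<exists>a b c d e. ind_P5 G a b c d e"
    then obtain a b c d e where q: "ind_P5 G a b c d e" by auto
    then have "{a, b, c, d, e} \<subseteq> verts G" using ind_P5_distinct[OF G] by blast
    then have "ind_P5 ?K (f a) (f b) (f c) (f d) (f e)"
      using ind_P5_embeds(1)[of a b c d e G ?K f] a q by auto
    then show "\<exists>a b c d e. ind_P5 ?K a b c d e" by blast
  next
    assume "\<exists>a b c d e. ind_P5 ?K a b c d e"
    then obtain a b c d e where q: "ind_P5 ?K a b c d e" by auto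
    then have "{a, b, c, d, e} \<subseteq> X" using ind_P5_distinct[OF K] vK by blast
    then obtain a' b' c' d' e' where e: "{a', b', c', d', e'} \<subseteq> verts G" "a = f a'" "b = f b'" "c = f c'"
      "d = f d'" "e = f e'" using X by auto
    then have "ind_P5 G a' b' c' d' e'"
      using ind_P5_embeds(1)[of a' b' c' d' e' G ?K f] a q by auto
    then show "\<exists>a b c d e. ind_P5 G a b c d e" by blast
  qed
  moreover have "(\<exists>a b c d e. ind_house G a b c d e) \<longleftrightarrow> (\<exists>a b c d e. ind_house ?K a b c d e)"
  proof
    assume "\<exists>a b c d e. ind_house G a b c d e"
    then obtain a b c d e where q: "ind_house G a b c d e" by auto
    then have "{a, b, c, d, e} \<subseteq> verts G" using ind_house_distinct[OF G] by blast
    then have "ind_house ?K (f a) (f b) (f c) (f d) (f e)"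
      using ind_P5_embeds(2)[of a b c d e G ?K f] a q by auto
    then show "\<exists>a b c d e. ind_house ?K a b c d e" by blast
  next
    assume "\<exists>a b c d e. ind_house ?K a b c d e"
    then obtain a b c d e where q: "ind_house ?K a b c d e" by auto
    then have "{a, b, c, d, e} \<subseteq> X" using ind_house_distinct[OF K] vK by blast
    then obtain a' b' c' d' e' where e: "{a', b', c', d', e'} \<subseteq> verts G" "a = f a'" "b = f b'" "c = f c'"
      "d = f d'" "e = f e'" using X by auto
    then have "ind_house G a' b' c' d' e'"
      using ind_P5_embeds(2)[of a' b' c' d' e' G ?K f] a q by auto
    then show "\<exists>a b c d e. ind_house G a b c d e" by blast
  qed
  ultimately show ?thesis unfolding P5_coP5_free_iff[OF K] P5_coP5_free_iff[OF G] by metis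
qed

lemma critical_family_embeds:
  assumes "simple_graph G" "simple_graph H" "embeds f G H" "f ` verts G = X"
  shows "induced H X \<in> critical_family m \<longleftrightarrow> G \<in> critical_family m"
  using critical_embeds[OF assms(1-3)] free_embeds[OF assms(1-4)] assms(1,4)
    simple_graph_induced[OF assms(2)]
  by (simp add: critical_family_def)

lemma critical_family_iso:
  assumes "simple_graph G" "simple_graph H" "graph_iso G H"
  shows "G \<in> critical_family m \<longleftrightarrow> H \<in> critical_family m"
proof -
  obtain f where "bij_betw f (verts G) (verts H)"
    "\<forall>x\<in>verts G. \<forall>y\<in>verts G. adj G x y \<longleftrightarrow> adj H (f x) (f y)"
    using assms(3) unfolding graph_iso_def by blast
  then have "embeds f G H" "f ` verts G = verts H" by (simp_all add: embeds_def bij_betw_def)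
  then show ?thesis
    using critical_family_embeds[OF assms(1,2)] induced_verts[OF assms(2)] by metis
qed

lemma free_induced:
  assumes "simple_graph G" "P5_coP5_free G"
  shows "P5_coP5_free (induced G S)"
proof -
  have "\<not> ind_P5 (induced G S) a b c d e" for a b c d e
  proof
    assume h: "ind_P5 (induced G S) a b c d e"
    have "{a, b, c, d, e} \<subseteq> S"
      using ind_P5_distinct[OF simple_graph_induced[OF assms(1)] h] by (simp add: induced_def)
    then have "ind_P5 G a b c d e" using h by (simp add: ind_P5_def adj_induced)
    then show False using assms(2) P5_coP5_free_iff[OF assms(1)] by blast
  qed
  moreover have "\<not> ind_house (induced G S) a b c d e" for a b c d e
  proof
    assume h: "ind_house (induced G S) a b c d e"
    have "{a, b, c, d, e} \<subseteq> S"
      using ind_house_distinct[OF simple_graph_induced[OF assms(1)] h] by (simp add: induced_def)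
    then have "ind_house G a b c d e" using h by (simp add: ind_house_def adj_induced)
    then show False using assms(2) P5_coP5_free_iff[OF assms(1)] by blast
  qed
  ultimately show ?thesis using P5_coP5_free_iff[OF simple_graph_induced[OF assms(1)]] by blast
qed

text \<open>The path on five vertices is prime: a labelling whose classes are modules is constant or
  injective on it. Applied to the complement, the lemma also covers houses.\<close>

lemma P5_labels:
  assumes sym: "\<And>x y. A x y \<longleftrightarrow> A y x"
    and p: "A a b" "A b c" "A c d" "A d e" "\<not> A a c" "\<not> A a d" "\<not> A a e" "\<not> A b d" "\<not> A b e" "\<not> A c e"
    and cl: "\<And>x y z. {x, y, z} \<subseteq> {a, b, c, d, e} \<Longrightarrow> q x = q y \<Longrightarrow> A z x \<Longrightarrow> \<not> A z y \<Longrightarrow> q z = q x"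
  shows "(q b = q a \<and> q c = q a \<and> q d = q a \<and> q e = q a) \<or> distinct [q a, q b, q c, q d, q e]"
    (is "?E \<or> _")
proof -
  have ps: "A b a" "A c b" "A d c" "A e d" "\<not> A c a" "\<not> A d a" "\<not> A e a" "\<not> A d b" "\<not> A e b" "\<not> A e c"
    using p sym by blast+
  \<comment> \<open>Equal labels on an end edge spread along the path, as each next vertex sees
    exactly one of two vertices already in the class. Every other coincidence leads back to
    \<open>ab\<close> or \<open>de\<close>.\<close>
  have ab: ?E if h: "q a = q b"
  proof -
    have c: "q c = q b" using cl[of b a c] h ps p by simp
    have d: "q d = q c" using cl[of c a d] h ps p c by simp
    have "q e = q d" using cl[of d a e] h ps p c d by simp
    then show ?E using h c d by simp
  qed
  have de: ?E if h: "q d = q e"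
  proof -
    have c: "q c = q d" using cl[of d e c] h ps p by simp
    have b: "q b = q c" using cl[of c e b] h ps p c by simp
    have "q a = q b" using cl[of b e a] h ps p c b by simp
    then show ?E using h c b by simp
  qed
  have bc: ?E if h: "q b = q c" using ab cl[of b c a] h ps p by simp
  have cd: ?E if h: "q c = q d" using de cl[of d c e] h ps p by simp
  have ac: ?E if h: "q a = q c" using cd cl[of c a d] h ps p by simp
  have bd: ?E if h: "q b = q d" using ab cl[of b d a] h ps p by simp
  have ce: ?E if h: "q c = q e" using bc cl[of c e b] h ps p by simp
  have ad: ?E if h: "q a = q d" using cd cl[of d a c] h ps p by simp
  have be: ?E if h: "q b = q e" using bc cl[of b e c] h ps p by simp
  have ae: ?E if h: "q a = q e" using de cl[of e a d] h ps p by simp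
  show ?thesis
    by (simp only: distinct.simps list.set insert_iff empty_iff) (metis ab ac ad ae bc bd be cd ce de)
qed

lemma blowupD:
  "blowup G p R \<Longrightarrow> x \<in> verts G \<Longrightarrow> y \<in> verts G \<Longrightarrow> p x \<noteq> p y \<Longrightarrow> adj G x y \<longleftrightarrow> R (p x) (p y)"
  unfolding blowup_def by blast

lemma blowup_P5_labels:
  assumes G: "simple_graph G" and b: "blowup G p R" and q: "ind_P5 G a b c d e \<or> ind_house G a b c d e"
  shows "(p b = p a \<and> p c = p a \<and> p d = p a \<and> p e = p a) \<or> distinct [p a, p b, p c, p d, p e]"
proof -
  have V: "{a, b, c, d, e} \<subseteq> verts G"
    using q ind_P5_distinct[OF G] ind_house_distinct[OF G] by blast
  have cl: "p z = p x" if "{x, y, z} \<subseteq> {a, b, c, d, e}" "p x = p y" "adj G z x" "\<not> adj G z y" for x y z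
  proof (rule ccontr)
    assume n: "p z \<noteq> p x"
    have "x \<in> verts G" "y \<in> verts G" "z \<in> verts G" using that(1) V by auto
    then show False using b n that(2-4) unfolding blowup_def by metis
  qed
  note sym = simple_graphD(4)[OF G]
  show ?thesis
  proof (cases "ind_P5 G a b c d e")
    case True
    then show ?thesis
      by (intro P5_labels[where A = "adj G", OF sym _ _ _ _ _ _ _ _ _ _ cl]) (simp_all add: ind_P5_def)
  next
    case False
    then have h: "ind_house G a b c d e" using q by blast
    let ?A = "\<lambda>x y. x \<noteq> y \<and> \<not> adj G x y"
    have "?A x y \<longleftrightarrow> ?A y x" for x y using sym by blast
    moreover have "p z = p x" if "{x, y, z} \<subseteq> {a, b, c, d, e}" "p x = p y" "?A z x" "\<not> ?A z y" for x y z
    \<comment> \<open>Here \<open>?A z y\<close> may fail because of \<open>z = y\<close> rather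
      than because of an edge; the label of \<open>z\<close> is then that of \<open>x\<close>
      anyway.\<close>
    proof (cases "z = y")
      case False
      then have "p z = p y" using cl[of y x z] that by simp
      then show ?thesis using that by simp
    qed (use that in simp)
    ultimately show ?thesis using ind_house_distinct[OF G h] h
      by (intro P5_labels[where A = ?A]) (simp_all add: ind_house_def)
  qed
qed

text \<open>A path or house lies within one bag or meets five different bags. Only the second kind
  depends on \<open>R\<close>, and \<open>five\<close> rules it out.\<close>

lemma blowup_free:
  assumes G: "simple_graph G" and b: "blowup G p R" and I: "p ` verts G \<subseteq> I"
    and B: "\<And>i. i \<in> I \<Longrightarrow> P5_coP5_free (induced G (bag G p i))"
    and five: "\<And>a b c d e. ind_P5 G a b c d e \<or> ind_house G a b c d e \<Longrightarrow>
      distinct [p a, p b, p c, p d, p e] \<Longrightarrow> {p a, p b, p c, p d, p e} \<subseteq> I \<Longrightarrow> False"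
  shows "P5_coP5_free G"
proof -
  have False if q: "ind_P5 G a b c d e \<or> ind_house G a b c d e" for a b c d e
  proof -
    have V: "{a, b, c, d, e} \<subseteq> verts G"
      using q ind_P5_distinct[OF G] ind_house_distinct[OF G] by blast
    then have pI: "{p a, p b, p c, p d, p e} \<subseteq> I" using I by auto
    then have "p b = p a \<and> p c = p a \<and> p d = p a \<and> p e = p a"
      using blowup_P5_labels[OF G b q] five[OF q] by metis
    then have m: "{a, b, c, d, e} \<subseteq> bag G p (p a)" using V by (simp add: bag_def)
    let ?K = "induced G (bag G p (p a))"
    have "ind_P5 ?K a b c d e \<or> ind_house ?K a b c d e"
      using q m by (simp add: ind_P5_def ind_house_def adj_induced)
    moreover have "P5_coP5_free ?K" using B pI by simp
    ultimately show False using P5_coP5_free_iff[OF simple_graph_induced[OF G]] by metis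
  qed
  then show ?thesis unfolding P5_coP5_free_iff[OF G] by metis
qed

section \<open>Joins and buoys of critical graphs are critical\<close>

lemma graph_join_critical_family:
  assumes H1: "H1 \<in> critical_family k1" and H2: "H2 \<in> critical_family k2" and k: "k1 \<ge> 1" "k2 \<ge> 1"
  shows "simple_graph (graph_join H1 H2)" "graph_join H1 H2 \<in> critical_family (k1 + k2)"
proof -
  have s: "simple_graph H1" "simple_graph H2" using H1 H2 by (auto simp: critical_family_def)
  let ?J = "graph_join H1 H2"
  have vJ: "verts ?J = verts H1 <+> verts H2" by (simp add: graph_join_def)
  have aJ: "adj ?J (Inl x) (Inl y) \<longleftrightarrow> adj H1 x y" "adj ?J (Inr u) (Inr v) \<longleftrightarrow> adj H2 u v"
    "adj ?J (Inl x) (Inr v) \<longleftrightarrow> x \<in> verts H1 \<and> v \<in> verts H2"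
    "adj ?J (Inr v) (Inl x) \<longleftrightarrow> v \<in> verts H2 \<and> x \<in> verts H1" for x y u v
    by (simp_all add: graph_join_def)
  show J: "simple_graph ?J"
    unfolding simple_graph_def
  proof (intro conjI allI impI)
    show "finite (verts ?J)" using s by (simp add: vJ simple_graph_def)
    fix x y
    show "adj ?J x y \<Longrightarrow> x \<in> verts ?J" "adj ?J x y \<Longrightarrow> y \<in> verts ?J" "adj ?J x y \<Longrightarrow> adj ?J y x"
      "\<not> adj ?J x x"
      using simple_graphD[OF s(1)] simple_graphD[OF s(2)]
      by (cases x; cases y; auto simp: aJ vJ)+
  qed
  let ?p = "\<lambda>u :: 'a + 'b. \<not> isl u"
  have b: "blowup ?J ?p (\<lambda>_ _. True)"
    unfolding blowup_def vJ by (auto simp: aJ)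
  have bags: "bag ?J ?p False = Inl ` verts H1" "bag ?J ?p True = Inr ` verts H2"
    unfolding bag_def vJ by auto
  have "embeds Inl H1 ?J" "embeds Inr H2 ?J" by (auto simp: embeds_def aJ vJ)
  then have "induced ?J (bag ?J ?p False) \<in> critical_family k1"
    "induced ?J (bag ?J ?p True) \<in> critical_family k2"
    unfolding bags using critical_family_embeds s J H1 H2 by blast+
  then have bf: "induced ?J (bag ?J ?p i) \<in> critical_family (if i then k2 else k1)" for i
    by (cases i) simp_all
  have "P5_coP5_free ?J"
  proof (rule blowup_free[OF J b subset_UNIV])
    show "P5_coP5_free (induced ?J (bag ?J ?p i))" for i
      using bf[of i] by (simp add: critical_family_def)
  \<comment> \<open>There are no five distinct labels in \<open>bool\<close>.\<close>
  qed auto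
  moreover have "critical (k1 + k2) ?J"
  proof (rule critical_blowupI[OF J b subset_UNIV])
    show "critical (if i then k2 else k1) (induced ?J (bag ?J ?p i))" for i
      using bf[of i] by (simp add: critical_family_def)
  qed (use k in \<open>auto simp: packs_join\<close>)
  ultimately show "?J \<in> critical_family (k1 + k2)" using J by (simp add: critical_family_def)
qed

lemma C5_nbrs: "i < 5 \<Longrightarrow> j < 5 \<Longrightarrow> C5 i j \<Longrightarrow> j \<in> {(i + 1) mod 5, (i + 4) mod 5}"
proof -
  have "\<forall>i<5. \<forall>j<5. C5 i j \<longrightarrow> j \<in> {(i + 1) mod 5, (i + 4) mod 5}"
    unfolding all_less_5 C5_def by simp
  then show "i < 5 \<Longrightarrow> j < 5 \<Longrightarrow> C5 i j \<Longrightarrow> ?thesis" by blast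
qed

lemma C5_non_nbrs:
  "i < 5 \<Longrightarrow> j < 5 \<Longrightarrow> i \<noteq> j \<Longrightarrow> \<not> C5 i j \<Longrightarrow> j \<in> {(i + 2) mod 5, (i + 3) mod 5}"
proof -
  have "\<forall>i<5. \<forall>j<5. i \<noteq> j \<and> \<not> C5 i j \<longrightarrow> j \<in> {(i + 2) mod 5, (i + 3) mod 5}"
    unfolding all_less_5 C5_def by simp
  then show "i < 5 \<Longrightarrow> j < 5 \<Longrightarrow> i \<noteq> j \<Longrightarrow> \<not> C5 i j \<Longrightarrow> ?thesis" by blast
qed

lemma adj_cycle_graph_5: "i < 5 \<Longrightarrow> j < 5 \<Longrightarrow> adj (cycle_graph 5) i j \<longleftrightarrow> C5 i j"
  by (simp add: cycle_graph_def C5_def)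

text \<open>The total \<open>2 * k - 1\<close> is one above the capacity \<open>2 * (k - 1)\<close>
  of k - 1 colours, so these fail, but they suffice once any weight is lowered by one.\<close>

lemma buoy_critical_family:
  fixes B :: "nat \<Rightarrow> 'a graph"
  assumes B: "\<And>i. i < 5 \<Longrightarrow> B i \<in> critical_family (ks i)" and ks: "\<And>i. i < 5 \<Longrightarrow> ks i \<ge> 1"
    and pair: "\<And>i. i < 5 \<Longrightarrow> ks i + ks ((i + 1) mod 5) \<le> k - 1"
    and total: "(\<Sum>i<5. ks i) = 2 * k - 1"
  shows "simple_graph (substitute (cycle_graph 5) B)"
    "substitute (cycle_graph 5) B \<in> critical_family k"
proof -
  have s: "simple_graph (B i)" if "i < 5" for i using B[OF that] by (simp add: critical_family_def)
  let ?J = "substitute (cycle_graph 5) B"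
  have vJ: "(i, x) \<in> verts ?J \<longleftrightarrow> i < 5 \<and> x \<in> verts (B i)" for i x
    by (simp add: substitute_def cycle_graph_def)
  have aJ: "adj ?J (i, x) (j, y) \<longleftrightarrow> i < 5 \<and> j < 5 \<and> x \<in> verts (B i) \<and> y \<in> verts (B j) \<and>
      (if i = j then adj (B i) x y else C5 i j)" for i x j y
    by (auto simp: substitute_def cycle_graph_def C5_def)
  show J: "simple_graph ?J"
    unfolding simple_graph_def
  proof (intro conjI allI impI)
    show "finite (verts ?J)" using s by (auto simp: substitute_def cycle_graph_def simple_graph_def)
    fix u v :: "nat \<times> 'a"
    obtain i x j y where uv: "u = (i, x)" "v = (j, y)" by fastforce
    show "adj ?J u v \<Longrightarrow> u \<in> verts ?J" "adj ?J u v \<Longrightarrow> v \<in> verts ?J" unfolding uv aJ vJ by simp_all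
    show "adj ?J u v \<Longrightarrow> adj ?J v u" unfolding uv aJ
      using simple_graphD(4)[OF s] by (auto simp: C5_def split: if_splits)
    show "\<not> adj ?J u u" unfolding uv aJ using simple_graphD(5)[OF s] by simp
  qed
  have b: "blowup ?J fst C5"
    unfolding blowup_def by (auto simp: aJ vJ)
  have I: "fst ` verts ?J \<subseteq> {..<5}" by (auto simp: vJ)
  have bf: "induced ?J (bag ?J fst i) \<in> critical_family (ks i)" if "i \<in> {..<5}" for i
  proof -
    have i: "i < 5" using that by simp
    have "Pair i ` verts (B i) = bag ?J fst i" using i by (auto simp: bag_def vJ)
    moreover have "embeds (Pair i) (B i) ?J" using i simple_graphD(2,3)[OF s[OF i]]
      by (auto simp: embeds_def aJ vJ inj_on_def)
    ultimately show ?thesis using critical_family_embeds[OF s[OF i] J] B[OF i] by blast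
  qed
  have "P5_coP5_free ?J"
  proof (rule blowup_free[OF J b I])
    show "P5_coP5_free (induced ?J (bag ?J fst i))" if "i \<in> {..<5}" for i
      using bf[OF that] by (simp add: critical_family_def)
  next
    fix u v x y z
    assume q: "ind_P5 ?J u v x y z \<or> ind_house ?J u v x y z"
      and d: "distinct [fst u, fst v, fst x, fst y, fst z]"
      and l: "{fst u, fst v, fst x, fst y, fst z} \<subseteq> {..<5}"
    have V: "{u, v, x, y, z} \<subseteq> verts ?J"
      using q ind_P5_distinct[OF J] ind_house_distinct[OF J] by blast
    then have a: "adj ?J u x \<longleftrightarrow> C5 (fst u) (fst x)" "adj ?J u y \<longleftrightarrow> C5 (fst u) (fst y)"
      "adj ?J u z \<longleftrightarrow> C5 (fst u) (fst z)"
    proof -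
      have v: "u \<in> verts ?J" "x \<in> verts ?J" "y \<in> verts ?J" "z \<in> verts ?J" using V by simp_all
      have ne: "fst u \<noteq> fst x" "fst u \<noteq> fst y" "fst u \<noteq> fst z" using d by simp_all
      show "adj ?J u x \<longleftrightarrow> C5 (fst u) (fst x)" by (rule blowupD[OF b v(1,2) ne(1)])
      show "adj ?J u y \<longleftrightarrow> C5 (fst u) (fst y)" by (rule blowupD[OF b v(1,3) ne(2)])
      show "adj ?J u z \<longleftrightarrow> C5 (fst u) (fst z)" by (rule blowupD[OF b v(1,4) ne(3)])
    qed
    have lt: "fst u < 5" "fst x < 5" "fst y < 5" "fst z < 5" using l by simp_all
    have ne: "fst u \<noteq> fst x" "fst u \<noteq> fst y" "fst u \<noteq> fst z" using d by simp_all
    have two: "\<not> (fst x \<in> {m, n} \<and> fst y \<in> {m, n} \<and> fst z \<in> {m, n})" for m n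
    proof -
      have "fst x \<noteq> fst y" "fst x \<noteq> fst z" "fst y \<noteq> fst z" using d by simp_all
      then show ?thesis by (simp only: insert_iff empty_iff) metis
    qed
    \<comment> \<open>The end \<open>u\<close> of an induced path has three non-neighbours among the
      other vertices, and in a house \<open>u\<close> has three neighbours. A vertex of the 5-cycle
      has only two of each.\<close>
    show False using q
    proof
      assume "ind_P5 ?J u v x y z"
      then have "\<not> C5 (fst u) (fst x)" "\<not> C5 (fst u) (fst y)" "\<not> C5 (fst u) (fst z)"
        using a by (simp_all add: ind_P5_def)
      then show False using two[of "(fst u + 2) mod 5" "(fst u + 3) mod 5"]
          C5_non_nbrs[OF lt(1,2) ne(1)] C5_non_nbrs[OF lt(1,3) ne(2)]
          C5_non_nbrs[OF lt(1,4) ne(3)] by blast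
    next
      assume "ind_house ?J u v x y z"
      then have "C5 (fst u) (fst x)" "C5 (fst u) (fst y)" "C5 (fst u) (fst z)"
        using a by (simp_all add: ind_house_def)
      then show False using two[of "(fst u + 1) mod 5" "(fst u + 4) mod 5"] C5_nbrs[OF lt(1,2)] C5_nbrs[OF lt(1,3)] C5_nbrs[OF lt(1,4)] by blast
    qed
  qed
  moreover have "critical k ?J"
  proof (rule critical_blowupI[OF J b I])
    show "critical (ks i) (induced ?J (bag ?J fst i))" if "i \<in> {..<5}" for i
      using bf[OF that] by (simp add: critical_family_def)
    show k: "k \<ge> 1" using pair[of 0] ks[of 0] by simp
    show "packs C5 {..<5} k ks" unfolding packs_C5 using pair total by fastforce
    have "\<not> sum ks {..<5} \<le> 2 * (k - 1)" using total k by linarith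
    then show "\<not> packs C5 {..<5} (k - 1) ks" unfolding packs_C5 by blast
    show "packs C5 {..<5} (k - 1) (ks (i := ks i - 1))" if i: "i \<in> {..<5}" for i
      unfolding packs_C5
    proof (intro conjI allI impI)
      let ?w = "ks (i := ks i - 1)"
      have le: "?w j \<le> ks j" for j by simp
      show "?w j + ?w ((j + 1) mod 5) \<le> k - 1" if "j < 5" for j
        using pair[OF that] le[of j] le[of "(j + 1) mod 5"] by linarith
      have "sum ?w {..<5} = ?w i + sum ?w ({..<5} - {i})" using i by (simp add: sum.remove)
      also have "sum ?w ({..<5} - {i}) = sum ks ({..<5} - {i})" by (rule sum.cong) auto
      finally have "sum ?w {..<5} + 1 = ks i + sum ks ({..<5} - {i})" using ks[of i] i by simp
      also have "\<dots> = sum ks {..<5}" using i by (simp add: sum.remove)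
      finally show "sum ?w {..<5} \<le> 2 * (k - 1)" using total by linarith
    qed
  qed
  ultimately show "?J \<in> critical_family k" using J by (simp add: critical_family_def)
qed

section \<open>Reading off the bags of a critical join or buoy\<close>

lemma join_of_blowup:
  assumes G: "G \<in> critical_family k" "k \<ge> 1" and b: "blowup G p (\<lambda>_ _. True)"
    and p: "p ` verts G = (UNIV :: bool set)"
  shows "\<exists>k1 k2 (H1 :: 'a graph) (H2 :: 'a graph). k1 \<ge> 1 \<and> k2 \<ge> 1 \<and> k1 + k2 = k \<and>
    H1 \<in> critical_family k1 \<and> H2 \<in> critical_family k2 \<and> graph_iso (G :: 'a graph) (graph_join H1 H2)"
proof -
  have s: "simple_graph G" and c: "critical k G" and f: "P5_coP5_free G"
    using G by (auto simp: critical_family_def)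
  let ?B = "bag G p" and ?H = "\<lambda>i. induced G (bag G p i)"
  have ne: "?B i \<noteq> {}" for i
  proof -
    have "i \<in> p ` verts G" using p by simp
    then show ?thesis by (auto simp: bag_def)
  qed
  have fam: "?H i \<in> critical_family (chi G (?B i))" for i
    using critical_bag[OF s b c G(2)] free_induced[OF s f] simple_graph_induced[OF s]
    by (simp add: critical_family_def)
  have "chi G (verts G) \<le> K \<longleftrightarrow> chi G (?B False) + chi G (?B True) \<le> K" for K
    using chi_blowup_verts[OF s b subset_UNIV] by (simp only: packs_join)
  \<comment> \<open>The equivalence holds for every \<open>K\<close>, so the two numbers bound each
    other.\<close>
  then have "chi G (verts G) = chi G (?B False) + chi G (?B True)" by (metis le_antisym order_refl)
  then have k: "chi G (?B False) + chi G (?B True) = k" using c critical_iff[OF s] by simp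
  have pos: "chi G (?B i) \<ge> 1" for i using chi_pos[OF s bag_subset ne] .
  let ?f = "\<lambda>x. if p x then Inr x else Inl x"
  have "graph_iso G (graph_join (?H False) (?H True))"
    unfolding graph_iso_def
  proof (intro exI[of _ ?f] conjI ballI)
    show "bij_betw ?f (verts G) (verts (graph_join (?H False) (?H True)))"
      unfolding bij_betw_def inj_on_def
      by (auto simp: graph_join_def verts_induced bag_subset bag_def image_iff split: if_splits)
    fix x y assume xy: "x \<in> verts G" "y \<in> verts G"
    then have "p x \<noteq> p y \<Longrightarrow> adj G x y" using b by (simp add: blowup_def)
    then show "adj G x y \<longleftrightarrow> adj (graph_join (?H False) (?H True)) (?f x) (?f y)"
      using xy by (auto simp: graph_join_def verts_induced bag_subset bag_def adj_induced)
  qed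
  then show ?thesis using pos k fam by blast
qed

lemma buoy_of_blowup:
  assumes G: "G \<in> critical_family k" "k \<ge> 1" and b: "blowup G p C5" and p: "p ` verts G = {..<5}"
  shows "\<exists>(B :: nat \<Rightarrow> 'a graph) ks. is_buoy (G :: 'a graph) B \<and>
    (\<forall>i<5. ks i \<ge> 1 \<and> B i \<in> critical_family (ks i)) \<and>
    (\<forall>i<5. ks i + ks ((i + 1) mod 5) \<le> k - 1) \<and> (\<Sum>i<5. ks i) = 2 * k - 1"
proof -
  have s: "simple_graph G" and c: "critical k G" and f: "P5_coP5_free G"
    using G by (auto simp: critical_family_def)
  let ?B = "bag G p" and ?H = "\<lambda>i. induced G (bag G p i)" and ?w = "\<lambda>i. chi G (bag G p i)"
  have ne: "?B i \<noteq> {}" if "i < 5" for i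
  proof -
    have "i \<in> p ` verts G" using p that by simp
    then show ?thesis by (auto simp: bag_def)
  qed
  have fam: "?H i \<in> critical_family (?w i)" for i
    using critical_bag[OF s b c G(2)] free_induced[OF s f] simple_graph_induced[OF s]
    by (simp add: critical_family_def)
  have pos: "?w i \<ge> 1" if "i < 5" for i using chi_pos[OF s bag_subset ne[OF that]] .
  have rem: "packs C5 {..<5} (k - 1) (?w (i := ?w i - 1))" if "i < 5" for i
    using critical_packs_remove[OF s b p c] that by simp
  have pair: "?w i + ?w ((i + 1) mod 5) \<le> k - 1" if i: "i < 5" for i
  proof -
    \<comment> \<open>Bag \<open>?j\<close> is off the edge between bags \<open>i\<close> and
      \<open>i + 1\<close>, so lowering its weight leaves both ends of that edge as they
      are.\<close>
    let ?j = "(i + 2) mod 5"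
    have "i \<noteq> ?j" "(i + 1) mod 5 \<noteq> ?j" using i by presburger+
    then show ?thesis using rem[of ?j] i unfolding packs_C5 by fastforce
  qed
  have k: "chi G (verts G) = k" using c critical_iff[OF s] by simp
  have "\<not> packs C5 {..<5} (k - 1) ?w"
    using chi_blowup_verts[OF s b eq_refl[OF p], of "k - 1"] k G(2) by linarith
  then have "2 * (k - 1) < sum ?w {..<5}" using pair unfolding packs_C5 by fastforce
  moreover have "sum ?w {..<5} \<le> 2 * (k - 1) + 1"
  proof -
    have "sum (?w (0 := ?w 0 - 1)) {..<5} \<le> 2 * (k - 1)" using rem[of 0] unfolding packs_C5 by simp
    then show ?thesis by (simp add: lessThan_5)
  qed
  ultimately have total: "sum ?w {..<5} = 2 * k - 1" using G(2) by linarith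
  let ?f = "\<lambda>x. (p x, x)"
  have "graph_iso G (substitute (cycle_graph 5) ?H)"
    unfolding graph_iso_def
  proof (intro exI[of _ ?f] conjI ballI)
    have v: "(i, x) \<in> verts (substitute (cycle_graph 5) ?H) \<longleftrightarrow> x \<in> verts G \<and> p x = i" for i x
      using p by (auto simp: substitute_def cycle_graph_def verts_induced bag_subset bag_def)
    show "bij_betw ?f (verts G) (verts (substitute (cycle_graph 5) ?H))"
      unfolding bij_betw_def inj_on_def using v by (auto simp: image_iff)
    fix x y assume xy: "x \<in> verts G" "y \<in> verts G"
    then have l: "p x < 5" "p y < 5" using p by auto
    have "p x \<noteq> p y \<Longrightarrow> adj G x y \<longleftrightarrow> C5 (p x) (p y)" using b xy by (simp add: blowup_def)
    then show "adj G x y \<longleftrightarrow> adj (substitute (cycle_graph 5) ?H) (?f x) (?f y)"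
      using xy l adj_cycle_graph_5[OF l]
      by (auto simp: substitute_def cycle_graph_def verts_induced bag_subset bag_def adj_induced)
  qed
  then have "is_buoy G ?H"
    unfolding is_buoy_def using ne by (simp add: simple_graph_induced[OF s] verts_induced bag_subset)
  then show ?thesis using pos fam pair total by (intro exI[of _ ?H] exI[of _ ?w]) simp
qed


section \<open>Critical graphs are joins or buoys\<close>

text \<open>\<open>p\<close> is consulted only on \<open>M\<close>, so that a buoy inside
  \<open>G\<close> can be enlarged by changing \<open>p\<close> at a single vertex. That all five
  labels occur says that no bag is empty.\<close>

definition buoy_on :: "'a graph \<Rightarrow> 'a set \<Rightarrow> ('a \<Rightarrow> nat) \<Rightarrow> bool" where
  "buoy_on G M p \<longleftrightarrow> M \<subseteq> verts G \<and> p ` M = {..<5} \<and>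
     (\<forall>x\<in>M. \<forall>y\<in>M. p x \<noteq> p y \<longrightarrow> (adj G x y \<longleftrightarrow> C5 (p x) (p y)))"

text \<open>The cutset \<open>C\<close> may be empty, so disconnected graphs are included.\<close>

definition separation :: "'a graph \<Rightarrow> 'a set \<Rightarrow> 'a set \<Rightarrow> 'a set \<Rightarrow> bool" where
  "separation G C A B \<longleftrightarrow> A \<noteq> {} \<and> B \<noteq> {} \<and> A \<union> B \<union> C = verts G \<and>
     A \<inter> B = {} \<and> A \<inter> C = {} \<and> B \<inter> C = {} \<and> (\<forall>x\<in>A. \<forall>y\<in>B. \<not> adj G x y)"

text \<open>The connected component of \<open>a\<close> in the subgraph induced on \<open>X\<close>,
  or just \<open>{a}\<close> if \<open>a\<close> lies outside \<open>X\<close>.\<close>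

definition component :: "'a graph \<Rightarrow> 'a set \<Rightarrow> 'a \<Rightarrow> 'a set" where
  "component G X a = {y. (a, y) \<in> {(u, w). u \<in> X \<and> w \<in> X \<and> adj G u w}\<^sup>*}"

section \<open>Vertices and modules around an induced 5-cycle\<close>

locale free_graph =
  fixes G :: "'a graph"
  assumes simple: "simple_graph G"
    and noP5: "\<not> ind_P5 G a b c d e"
    and nohouse: "\<not> ind_house G a b c d e"
begin

abbreviation "E \<equiv> adj G"
abbreviation "V \<equiv> verts G"

lemma E_sym: "E x y \<longleftrightarrow> E y x"
  by (rule simple_graphD(4)[OF simple])

lemma E_irrefl: "\<not> E x x"
  by (rule simple_graphD(5)[OF simple])

definition ind_C5 :: "'a \<Rightarrow> 'a \<Rightarrow> 'a \<Rightarrow> 'a \<Rightarrow> 'a \<Rightarrow> bool" where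
  "ind_C5 a b c d e \<longleftrightarrow> E a b \<and> E b c \<and> E c d \<and> E d e \<and> E e a \<and>
     \<not> E a c \<and> \<not> E a d \<and> \<not> E b d \<and> \<not> E b e \<and> \<not> E c e"

lemma ind_C5_rotate: "ind_C5 a b c d e \<Longrightarrow> ind_C5 b c d e a"
  using E_sym[of d a] E_sym[of c a] E_sym[of b a] by (simp add: ind_C5_def)

lemma ind_C5_reflect: "ind_C5 a b c d e \<Longrightarrow> ind_C5 a e d c b"
  using E_sym[of a e] E_sym[of e d] E_sym[of d c] E_sym[of c b] E_sym[of b a] E_sym[of e c]
    E_sym[of e b] E_sym[of d b] by (simp add: ind_C5_def)

text \<open>\<open>v, a, b, c, d\<close> would be an induced path, whether or not \<open>v\<close>
  sees \<open>e\<close>.\<close>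

lemma C5_three_misses: "ind_C5 a b c d e \<Longrightarrow> E v a \<Longrightarrow> \<not> E v b \<Longrightarrow> \<not> E v c \<Longrightarrow> \<not> E v d \<Longrightarrow> False"
  using noP5[of v a b c d] by (simp add: ind_P5_def ind_C5_def)

text \<open>The 4-cycle \<open>v, e, a, b\<close> with roof \<open>c\<close> would be a house,
  whether or not \<open>v\<close> sees \<open>d\<close>.\<close>

lemma C5_three_hits: "ind_C5 a b c d e \<Longrightarrow> \<not> E v a \<Longrightarrow> E v b \<Longrightarrow> E v c \<Longrightarrow> E v e \<Longrightarrow> False"
  using nohouse[of v a c e b] E_sym[of e b] E_sym[of e a] E_sym[of c b]
  by (simp add: ind_house_def ind_C5_def)

text \<open>\<open>v\<close> can take the place of \<open>a\<close> in the 5-cycle. Whether it sees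
  \<open>a\<close> itself is left open, since both may sit in one bag.\<close>

definition twin :: "'a \<Rightarrow> 'a \<Rightarrow> 'a \<Rightarrow> 'a \<Rightarrow> 'a \<Rightarrow> 'a \<Rightarrow> bool" where
  "twin v a b c d e \<longleftrightarrow> E v b \<and> E v e \<and> \<not> E v c \<and> \<not> E v d"

text \<open>The rotations of \<open>C5_three_misses\<close> and of \<open>C5_three_hits\<close>
  exclude ten each of the 32 conceivable neighbourhoods; these twelve remain.\<close>

lemma C5_neighbours:
  assumes h: "ind_C5 a b c d e"
  shows "(E v a \<and> E v b \<and> E v c \<and> E v d \<and> E v e) \<or> (\<not> E v a \<and> \<not> E v b \<and> \<not> E v c \<and> \<not> E v d \<and> \<not> E v e) \<or>
    twin v a b c d e \<or> twin v b c d e a \<or> twin v c d e a b \<or> twin v d e a b c \<or> twin v e a b c d"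
proof -
  note r1 = ind_C5_rotate[OF h]
  note r2 = ind_C5_rotate[OF r1]
  note r3 = ind_C5_rotate[OF r2]
  note r4 = ind_C5_rotate[OF r3]
  note m = C5_three_misses[of _ _ _ _ _ v] and t = C5_three_hits[of _ _ _ _ _ v]
  have "\<not> (E v a \<and> \<not> E v b \<and> \<not> E v c \<and> \<not> E v d)" "\<not> (E v b \<and> \<not> E v c \<and> \<not> E v d \<and> \<not> E v e)"
    "\<not> (E v c \<and> \<not> E v d \<and> \<not> E v e \<and> \<not> E v a)" "\<not> (E v d \<and> \<not> E v e \<and> \<not> E v a \<and> \<not> E v b)"
    "\<not> (E v e \<and> \<not> E v a \<and> \<not> E v b \<and> \<not> E v c)"
    using m[OF h] m[OF r1] m[OF r2] m[OF r3] m[OF r4] by blast+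
  moreover have "\<not> (\<not> E v a \<and> E v b \<and> E v c \<and> E v e)" "\<not> (\<not> E v b \<and> E v c \<and> E v d \<and> E v a)"
    "\<not> (\<not> E v c \<and> E v d \<and> E v e \<and> E v b)" "\<not> (\<not> E v d \<and> E v e \<and> E v a \<and> E v c)"
    "\<not> (\<not> E v e \<and> E v a \<and> E v b \<and> E v d)"
    using t[OF h] t[OF r1] t[OF r2] t[OF r3] t[OF r4] by blast+
  ultimately show ?thesis unfolding twin_def
    by (cases "E v a"; cases "E v b"; cases "E v c"; cases "E v d"; cases "E v e"; simp)
qed

text \<open>Exchanging one vertex of the cycle for another in its position keeps \<open>v\<close> a
  twin: the three other known adjacencies together with the wrong one would violate
  \<open>C5_three_misses\<close> or \<open>C5_three_hits\<close>.\<close>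

lemma twin_replace:
  assumes "twin v a b c d e"
  shows "ind_C5 a b' c d e \<Longrightarrow> E v b'" "ind_C5 a b c' d e \<Longrightarrow> \<not> E v c'"
    "ind_C5 a b c d' e \<Longrightarrow> \<not> E v d'" "ind_C5 a b c d e' \<Longrightarrow> E v e'"
proof -
  have t: "E v b" "E v e" "\<not> E v c" "\<not> E v d" using assms by (simp_all add: twin_def)
  have rr: "ind_C5 c d e a b" if "ind_C5 a b c d e" for a b c d e
    using ind_C5_rotate[OF ind_C5_rotate[OF that]] .
  show "E v b'" if "ind_C5 a b' c d e"
    using C5_three_misses[OF ind_C5_rotate[OF ind_C5_reflect[OF that]], of v] t by blast
  show "E v e'" if "ind_C5 a b c d e'"
    using C5_three_misses[OF ind_C5_rotate[OF that], of v] t by blast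
  show "\<not> E v d'" if "ind_C5 a b c d' e"
    using C5_three_hits[OF rr[OF that], of v] t by blast
  show "\<not> E v c'" if "ind_C5 a b c' d e"
    using C5_three_hits[OF rr[OF ind_C5_reflect[OF that]], of v] t by blast
qed

lemma buoy_transversal:
  assumes b: "buoy_on G M p" and i: "i < 5"
    and x: "x0 \<in> M" "x1 \<in> M" "x2 \<in> M" "x3 \<in> M" "x4 \<in> M"
    and l: "p x0 = i" "p x1 = (i + 1) mod 5" "p x2 = (i + 2) mod 5" "p x3 = (i + 3) mod 5"
      "p x4 = (i + 4) mod 5"
  shows "ind_C5 x0 x1 x2 x3 x4"
proof -
  have a: "E x y \<longleftrightarrow> C5 (p x) (p y)" if "x \<in> M" "y \<in> M" "p x \<noteq> p y" for x y
    using b that by (simp add: buoy_on_def)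
  have c: "\<forall>i<5::nat. i \<noteq> (i + 1) mod 5 \<and> i \<noteq> (i + 2) mod 5 \<and> i \<noteq> (i + 3) mod 5 \<and> (i + 4) mod 5 \<noteq> i \<and>
    (i + 1) mod 5 \<noteq> (i + 2) mod 5 \<and> (i + 1) mod 5 \<noteq> (i + 3) mod 5 \<and> (i + 1) mod 5 \<noteq> (i + 4) mod 5 \<and>
    (i + 2) mod 5 \<noteq> (i + 3) mod 5 \<and> (i + 2) mod 5 \<noteq> (i + 4) mod 5 \<and> (i + 3) mod 5 \<noteq> (i + 4) mod 5"
    unfolding all_less_5 by simp
  have d: "\<forall>i<5. C5 i ((i + 1) mod 5) \<and> C5 ((i + 1) mod 5) ((i + 2) mod 5) \<and>
    C5 ((i + 2) mod 5) ((i + 3) mod 5) \<and> C5 ((i + 3) mod 5) ((i + 4) mod 5) \<and> C5 ((i + 4) mod 5) i \<and>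
    \<not> C5 i ((i + 2) mod 5) \<and> \<not> C5 i ((i + 3) mod 5) \<and> \<not> C5 ((i + 1) mod 5) ((i + 3) mod 5) \<and>
    \<not> C5 ((i + 1) mod 5) ((i + 4) mod 5) \<and> \<not> C5 ((i + 2) mod 5) ((i + 4) mod 5)"
    unfolding all_less_5 C5_def by simp
  have c': "p x0 \<noteq> p x1" "p x1 \<noteq> p x2" "p x2 \<noteq> p x3" "p x3 \<noteq> p x4" "p x4 \<noteq> p x0" "p x0 \<noteq> p x2"
    "p x0 \<noteq> p x3" "p x1 \<noteq> p x3" "p x1 \<noteq> p x4" "p x2 \<noteq> p x4"
    unfolding l using c[rule_format, OF i] by simp_all
  show ?thesis unfolding ind_C5_def
    using a[OF x(1,2) c'(1)] a[OF x(2,3) c'(2)] a[OF x(3,4) c'(3)] a[OF x(4,5) c'(4)]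
      a[OF x(5,1) c'(5)] a[OF x(1,3) c'(6)] a[OF x(1,4) c'(7)] a[OF x(2,4) c'(8)]
      a[OF x(2,5) c'(9)] a[OF x(3,5) c'(10)]
    unfolding l using d[rule_format, OF i] by simp
qed

text \<open>On some 5-cycle with one vertex in each bag, \<open>v\<close> sees some vertices but not
  all, hence it is a twin of one of them. Exchanging a single vertex of that cycle then shows that
  \<open>v\<close> attaches to the whole of \<open>M\<close> like a vertex of that bag.\<close>

lemma buoy_extend:
  assumes b: "buoy_on G M p" and v: "v \<in> V" "v \<notin> M"
    and mixed: "\<exists>x\<in>M. E v x" "\<exists>y\<in>M. \<not> E v y"
  shows "\<exists>q. buoy_on G (insert v M) q"
proof -
  have M: "M \<subseteq> V" and p: "p ` M = {..<5}"
    and a: "\<And>x y. x \<in> M \<Longrightarrow> y \<in> M \<Longrightarrow> p x \<noteq> p y \<Longrightarrow> E x y \<longleftrightarrow> C5 (p x) (p y)"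
    using b by (simp_all add: buoy_on_def)
  have "\<exists>x. x \<in> M \<and> p x = i" if "i < 5" for i
  proof -
    have "i \<in> p ` M" using p that by simp
    then show ?thesis by blast
  qed
  then obtain s where s: "\<And>i. i < 5 \<Longrightarrow> s i \<in> M" "\<And>i. i < 5 \<Longrightarrow> p (s i) = i" by metis
  \<comment> \<open>The two witnesses must lie in different bags to fit on one 5-cycle. If they
    share a bag, a vertex \<open>z\<close> of another bag replaces one of them.\<close>
  obtain x y where xy: "x \<in> M" "y \<in> M" "E v x" "\<not> E v y" "p x \<noteq> p y"
  proof -
    obtain x y where h: "x \<in> M" "E v x" "y \<in> M" "\<not> E v y" using mixed by blast
    define z where "z = s (if p x = 0 then 1 else 0)"
    have z: "z \<in> M" "p z \<noteq> p x" unfolding z_def using s by simp_all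
    show thesis
    proof (cases "p x = p y")
      case eq: True
      show thesis
      proof (cases "E v z")
        case True
        show thesis by (rule that[of z y]) (use h z True eq in simp_all)
      next
        case False
        show thesis by (rule that[of x z]) (use h z False in simp_all)
      qed
    next
      case False
      show thesis by (rule that[of x y]) (use h False in simp_all)
    qed
  qed
  define t where "t = s (p x := x, p y := y)"
  have t: "t i \<in> M" "p (t i) = i" if "i < 5" for i using s[OF that] xy by (simp_all add: t_def)
  have lxy: "p x < 5" "p y < 5" using p xy by auto
  have tx: "t (p x) = x" "t (p y) = y" using xy by (simp_all add: t_def)
  have "\<exists>i<5. twin v (t i) (t ((i + 1) mod 5)) (t ((i + 2) mod 5)) (t ((i + 3) mod 5)) (t ((i + 4) mod 5))"
  proof -
    have c: "ind_C5 (t 0) (t 1) (t 2) (t 3) (t 4)"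
      by (rule buoy_transversal[OF b, of 0]) (use t in simp_all)
    have "\<not> (\<forall>i<5. E v (t i))" using tx(2) xy(4) lxy(2) by metis
    moreover have "\<not> (\<forall>i<5. \<not> E v (t i))" using tx(1) xy(3) lxy(1) by metis
    ultimately have "twin v (t 0) (t 1) (t 2) (t 3) (t 4) \<or> twin v (t 1) (t 2) (t 3) (t 4) (t 0) \<or>
      twin v (t 2) (t 3) (t 4) (t 0) (t 1) \<or> twin v (t 3) (t 4) (t 0) (t 1) (t 2) \<or>
      twin v (t 4) (t 0) (t 1) (t 2) (t 3)"
      using C5_neighbours[OF c, of v] unfolding all_less_5 by blast
    then show ?thesis
    proof (elim disjE)
      assume "twin v (t 0) (t 1) (t 2) (t 3) (t 4)"
      then show ?thesis by (intro exI[of _ 0]) (simp add: numeral_2_eq_2)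
    next
      assume "twin v (t 1) (t 2) (t 3) (t 4) (t 0)"
      then show ?thesis by (intro exI[of _ 1]) (simp add: numeral_2_eq_2)
    next
      assume "twin v (t 2) (t 3) (t 4) (t 0) (t 1)"
      then show ?thesis by (intro exI[of _ 2]) (simp add: numeral_2_eq_2)
    next
      assume "twin v (t 3) (t 4) (t 0) (t 1) (t 2)"
      then show ?thesis by (intro exI[of _ 3]) (simp add: numeral_2_eq_2)
    next
      assume "twin v (t 4) (t 0) (t 1) (t 2) (t 3)"
      then show ?thesis by (intro exI[of _ 4]) (simp add: numeral_2_eq_2)
    qed
  qed
  then obtain i where i: "i < 5"
    and tw: "twin v (t i) (t ((i + 1) mod 5)) (t ((i + 2) mod 5)) (t ((i + 3) mod 5)) (t ((i + 4) mod 5))"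
    by blast
  have m: "(i + n) mod 5 < 5" for n by simp
  have nb: "E v z \<longleftrightarrow> C5 i (p z)" if z: "z \<in> M" "p z \<noteq> i" for z
  proof -
    note tr = buoy_transversal[OF b i]
    have lz: "p z < 5" using p z by auto
    have "\<forall>i<5. \<forall>l<5. l \<noteq> i \<longrightarrow> l = (i + 1) mod 5 \<and> C5 i l \<or> l = (i + 2) mod 5 \<and> \<not> C5 i l \<or>
      l = (i + 3) mod 5 \<and> \<not> C5 i l \<or> l = (i + 4) mod 5 \<and> C5 i l"
      unfolding all_less_5 C5_def by simp
    then consider "p z = (i + 1) mod 5" "C5 i (p z)" | "p z = (i + 2) mod 5" "\<not> C5 i (p z)"
      | "p z = (i + 3) mod 5" "\<not> C5 i (p z)" | "p z = (i + 4) mod 5" "C5 i (p z)"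
      using i lz z(2) by blast
    then show ?thesis
    proof cases
      case 1
      have "E v z" by (rule twin_replace(1)[OF tw], rule tr) (use t i m z 1 in simp_all)
      then show ?thesis using 1 by simp
    next
      case 2
      have "\<not> E v z" by (rule twin_replace(2)[OF tw], rule tr) (use t i m z 2 in simp_all)
      then show ?thesis using 2 by simp
    next
      case 3
      have "\<not> E v z" by (rule twin_replace(3)[OF tw], rule tr) (use t i m z 3 in simp_all)
      then show ?thesis using 3 by simp
    next
      case 4
      have "E v z" by (rule twin_replace(4)[OF tw], rule tr) (use t i m z 4 in simp_all)
      then show ?thesis using 4 by simp
    qed
  qed
  let ?q = "p (v := i)"
  have "?q ` insert v M = {..<5}"
  proof -
    have "?q ` M = p ` M" by (rule image_cong) (use v in auto)
    then show ?thesis using p i by auto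
  qed
  moreover have "E x y \<longleftrightarrow> C5 (?q x) (?q y)"
    if h: "x \<in> insert v M" "y \<in> insert v M" "?q x \<noteq> ?q y" for x y
  proof -
    have C5_sym: "C5 l l' \<longleftrightarrow> C5 l' l" for l l' by (auto simp: C5_def)
    consider "x = v" "y \<in> M" "y \<noteq> v" | "y = v" "x \<in> M" "x \<noteq> v" | "x \<in> M" "y \<in> M" "x \<noteq> v" "y \<noteq> v"
      using h by fastforce
    then show ?thesis
    proof cases
      case 1
      then show ?thesis using nb[of y] h(3) by simp
    next
      case 2
      then show ?thesis using nb[of x] h(3) E_sym[of x v] C5_sym[of i "p x"] by simp
    next
      case 3
      then show ?thesis using a h(3) by simp
    qed
  qed
  ultimately have "buoy_on G (insert v M) ?q" using M v unfolding buoy_on_def by simp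
  then show ?thesis by (rule exI[of _ ?q])
qed

text \<open>Take a buoy of maximum cardinality around the cycle: by \<open>buoy_extend\<close>, an
  outside vertex with both kinds of adjacency to it would enlarge it.\<close>

lemma C5_in_buoy_module:
  assumes c: "ind_C5 a b c d e"
  obtains M p where "{a, b, c, d, e} \<subseteq> M" "buoy_on G M p"
    "\<And>v. v \<in> V \<Longrightarrow> v \<notin> M \<Longrightarrow> (\<forall>x\<in>M. E v x) \<or> (\<forall>x\<in>M. \<not> E v x)"
proof -
  let ?Q = "{a, b, c, d, e}"
  let ?P = "\<lambda>M. ?Q \<subseteq> M \<and> (\<exists>p. buoy_on G M p)"
  let ?p = "\<lambda>x. if x = a then 0 else if x = b then 1 else if x = c then 2 else if x = d then 3 else 4 :: nat"
  have ne: "b \<noteq> a" "c \<noteq> a" "c \<noteq> b" "d \<noteq> a" "d \<noteq> b" "d \<noteq> c" "e \<noteq> a" "e \<noteq> b" "e \<noteq> c" "e \<noteq> d"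
    using c E_irrefl E_sym unfolding ind_C5_def by metis+
  have pv: "?p a = 0" "?p b = 1" "?p c = 2" "?p d = 3" "?p e = 4" using ne by simp_all
  have "buoy_on G ?Q ?p"
    unfolding buoy_on_def
  proof (intro conjI)
    show "?Q \<subseteq> V" using c simple_graphD(2,3)[OF simple] unfolding ind_C5_def by blast
    show "?p ` ?Q = {..<5}" unfolding lessThan_5 image_insert image_empty pv by simp
    have adjs: "E a b" "E b a" "E b c" "E c b" "E c d" "E d c" "E d e" "E e d" "E e a" "E a e"
      "\<not> E a c" "\<not> E c a" "\<not> E a d" "\<not> E d a" "\<not> E b d" "\<not> E d b" "\<not> E b e" "\<not> E e b" "\<not> E c e" "\<not> E e c"
      using c E_sym unfolding ind_C5_def by blast+
    show "\<forall>x\<in>?Q. \<forall>y\<in>?Q. ?p x \<noteq> ?p y \<longrightarrow> (E x y \<longleftrightarrow> C5 (?p x) (?p y))"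
      unfolding ball_simps pv using adjs by (simp add: C5_def)
  qed
  then have "?P ?Q" by blast
  moreover have "\<forall>M. ?P M \<longrightarrow> card M < Suc (card V)"
    using simple_graphD(1)[OF simple] by (auto simp: buoy_on_def less_Suc_eq_le intro: card_mono)
  ultimately have "\<exists>M. ?P M \<and> (\<forall>M'. ?P M' \<longrightarrow> card M' \<le> card M)"
    by (rule ex_has_greatest_nat)
  then obtain M where M: "?P M" "\<And>M'. ?P M' \<Longrightarrow> card M' \<le> card M" by (elim exE conjE) blast
  then obtain p where p: "buoy_on G M p" by blast
  have fin: "finite M" using p simple_graphD(1)[OF simple] finite_subset by (auto simp: buoy_on_def)
  have "(\<forall>x\<in>M. E v x) \<or> (\<forall>x\<in>M. \<not> E v x)" if v: "v \<in> V" "v \<notin> M" for v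
  proof (rule ccontr)
    assume "\<not> ((\<forall>x\<in>M. E v x) \<or> (\<forall>x\<in>M. \<not> E v x))"
    then have "\<exists>q. buoy_on G (insert v M) q" by (intro buoy_extend[OF p v]) blast+
    then have "card (insert v M) \<le> card M" using M by (intro M(2)) blast
    then show False using fin v by simp
  qed
  then show thesis using that[of M p] M(1) p by blast
qed

text \<open>A shortest path is induced, so here it has at most three edges. The nonadjacencies
  listed are those that make the path induced.\<close>

lemma P5_free_distance:
  assumes "(x, y) \<in> {(u, w). u \<in> X \<and> w \<in> X \<and> E u w}\<^sup>*"
  shows "x = y \<or> E x y \<or> (\<exists>p\<in>X. E x p \<and> E p y \<and> \<not> E x y) \<or>
    (\<exists>p\<in>X. \<exists>q\<in>X. E x p \<and> E p q \<and> E q y \<and> \<not> E x q \<and> \<not> E x y \<and> \<not> E p y)"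
  using assms
proof (induction rule: rtrancl_induct)
  case base
  then show ?case by simp
next
  case (step y z)
  have yz: "y \<in> X" "z \<in> X" "E y z" using step(2) by auto
  show ?case
  proof (cases "E x z")
    case xz: False
    consider "x = y" | "E x y" | p where "p \<in> X" "E x p" "E p y" "\<not> E x y"
      | p q where "p \<in> X" "q \<in> X" "E x p" "E p q" "E q y" "\<not> E x q" "\<not> E x y" "\<not> E p y"
      using step(3) by blast
    then show ?thesis
    proof cases
      case 1
      then show ?thesis using yz by simp
    next
      case 2
      then show ?thesis using yz xz by blast
    next
      case 3
      then show ?thesis using yz xz by blast
    next
      case 4
      \<comment> \<open>Otherwise a fourth edge would complete an induced path on five vertices; so
        \<open>z\<close> can be reached earlier.\<close>
      then have "E p z \<or> E q z" using noP5[of x p q y z] yz xz by (simp add: ind_P5_def)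
      then show ?thesis using 4 yz xz by blast
    qed
  qed simp
qed

end

section \<open>Components and separations\<close>

lemma component_self: "a \<in> component G X a"
  by (simp add: component_def)

lemma component_subset: "a \<in> X \<Longrightarrow> component G X a \<subseteq> X"
proof
  fix y
  assume a: "a \<in> X" and "y \<in> component G X a"
  then have "(a, y) \<in> {(u, w). u \<in> X \<and> w \<in> X \<and> adj G u w}\<^sup>*" by (simp add: component_def)
  then show "y \<in> X" by (induction rule: rtrancl_induct) (use a in auto)
qed

lemma component_step:
  "y \<in> component G X a \<Longrightarrow> y \<in> X \<Longrightarrow> z \<in> X \<Longrightarrow> adj G y z \<Longrightarrow> z \<in> component G X a"
  unfolding component_def by (auto intro: rtrancl_into_rtrancl)

text \<open>Walks from \<open>a\<close> never leave the component, so the connection runs inside it.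
  This keeps the inner vertices of short paths on one side of the cutset.\<close>

lemma component_connected:
  assumes G: "simple_graph G" and x: "x \<in> component G X a" and y: "y \<in> component G X a"
  shows "(x, y) \<in> {(u, w). u \<in> component G X a \<and> w \<in> component G X a \<and> adj G u w}\<^sup>*"
proof -
  let ?R = "{(u, w). u \<in> component G X a \<and> w \<in> component G X a \<and> adj G u w}"
  have from_a: "(a, z) \<in> ?R\<^sup>*" if "z \<in> component G X a" for z
  proof -
    from that have "(a, z) \<in> {(u, w). u \<in> X \<and> w \<in> X \<and> adj G u w}\<^sup>*" by (simp add: component_def)
    then show ?thesis
    proof (induction rule: rtrancl_induct)
      case (step u w)
      have "u \<in> component G X a" using step(1) by (simp add: component_def)
      moreover have "w \<in> component G X a"
        by (rule component_step[OF \<open>u \<in> component G X a\<close>]) (use step(2) in simp_all)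
      ultimately show ?case using step(2,3) by (auto intro: rtrancl_into_rtrancl)
    qed simp
  qed
  have "sym ?R" using simple_graphD(4)[OF G] by (auto simp: sym_def)
  then have "(x, a) \<in> ?R\<^sup>*" by (rule symD[OF sym_rtrancl from_a[OF x]])
  then show ?thesis using from_a[OF y] by (rule rtrancl_trans)
qed

lemma separation_sym: "simple_graph G \<Longrightarrow> separation G C A B \<Longrightarrow> separation G C B A"
  unfolding separation_def using simple_graphD(4) by (metis Int_commute Un_commute)

lemma separation_component:
  assumes "separation G C A B" "a \<in> A"
  shows "component G (verts G - C) a \<subseteq> A"
proof
  fix y
  assume "y \<in> component G (verts G - C) a"
  then have "(a, y) \<in> {(u, w). u \<in> verts G - C \<and> w \<in> verts G - C \<and> adj G u w}\<^sup>*"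
    by (simp add: component_def)
  then show "y \<in> A"
    by (induction rule: rtrancl_induct) (use assms in \<open>auto simp: separation_def\<close>)
qed

section \<open>Minimum cutsets of graphs that are neither joins nor buoys\<close>

text \<open>\<open>no_join\<close> expresses that the complement is connected. Criticality is absent
  here and enters only when colourings are glued.\<close>

locale prime_cut = free_graph G for G :: "'a graph" +
  fixes C A B :: "'a set"
  assumes sep: "separation G C A B"
    and minimal: "separation G C' A' B' \<Longrightarrow> card C \<le> card C'"
    and no_join: "X \<noteq> {} \<Longrightarrow> Y \<noteq> {} \<Longrightarrow> X \<union> Y = verts G \<Longrightarrow> X \<inter> Y = {} \<Longrightarrow> \<exists>x\<in>X. \<exists>y\<in>Y. \<not> adj G x y"
    and no_buoy: "\<not> buoy_on G (verts G) p"
begin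

text \<open>The sides play the same role; interpreting this carries every result about
  \<open>A\<close> over to \<open>B\<close>.\<close>

lemma prime_cut_swap: "prime_cut G C B A"
proof
  show "separation G C B A" using separation_sym[OF simple sep] .
  show "card C \<le> card C'" if "separation G C' A' B'" for C' A' B' using that by (rule minimal)
  show "\<exists>x\<in>X. \<exists>y\<in>Y. \<not> adj G x y" if "X \<noteq> {}" "Y \<noteq> {}" "X \<union> Y = verts G" "X \<inter> Y = {}" for X Y
    using that by (rule no_join)
  show "\<not> buoy_on G (verts G) p" for p by (rule no_buoy)
qed

lemma finC: "finite C"
  using sep simple_graphD(1)[OF simple] finite_subset[of C V] by (auto simp: separation_def)

abbreviation "side a \<equiv> component G (V - C) a"

lemma sepD: "A \<subseteq> V - C" "B \<subseteq> V - C" "C \<subseteq> V" "x \<in> V \<Longrightarrow> x \<in> A \<or> x \<in> B \<or> x \<in> C"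
  "x \<in> A \<Longrightarrow> y \<in> B \<Longrightarrow> \<not> E x y" "x \<in> A \<Longrightarrow> y \<in> B \<Longrightarrow> \<not> E y x"
proof -
  show "x \<in> A \<Longrightarrow> y \<in> B \<Longrightarrow> \<not> E x y" using sep by (simp add: separation_def)
  then show "x \<in> A \<Longrightarrow> y \<in> B \<Longrightarrow> \<not> E y x" using E_sym by blast
qed (use sep in \<open>auto simp: separation_def\<close>)

text \<open>Otherwise \<open>c\<close> could be moved to the side away from this component, and
  \<open>C - {c}\<close> would be a smaller cutset.\<close>

lemma comp_full:
  assumes a: "a \<in> A" and c: "c \<in> C"
  shows "\<exists>y\<in>side a. E c y"
proof (rule ccontr)
  assume n: "\<not> (\<exists>y\<in>side a. E c y)"
  have ac: "side a \<subseteq> V - C" using component_subset[of a "V - C"] a sepD(1) by blast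
  have "separation G (C - {c}) (side a) ((V - C - side a) \<union> {c})"
    unfolding separation_def
  proof (intro conjI ballI)
    show "side a \<noteq> {}" using component_self by fast
    show "side a \<union> ((V - C - side a) \<union> {c}) \<union> (C - {c}) = V" using ac c sepD(3) by blast
    fix x y
    assume x: "x \<in> side a" and y: "y \<in> (V - C - side a) \<union> {c}"
    show "\<not> E x y"
    proof (cases "y = c")
      case True
      then show ?thesis using n x E_sym by blast
    next
      case False
      then show ?thesis using component_step[OF x, of y] x y ac by blast
    qed
  qed (use ac c in auto)
  then have "card C \<le> card (C - {c})" by (rule minimal)
  then show False using finC c by (meson card_Diff1_less not_le)
qed

text \<open>\<open>N\<close> consists of the vertices outside the module \<open>M\<close> that see
  all of it. Some vertex outside \<open>M\<close> sees none of it, for otherwise \<open>M\<close>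
  and \<open>V - M\<close> would form a join; so \<open>N\<close> is a cutset. Its vertices see both
  \<open>a\<close> and \<open>b\<close>, hence lie in \<open>C\<close>, and \<open>d\<close> is not
  among them because it lies in \<open>M\<close>.\<close>

lemma no_crossing_C5:
  assumes c: "ind_C5 x0 x1 x2 x3 x4" and Q: "Q = {x0, x1, x2, x3, x4}"
    and m: "a \<in> A" "a \<in> Q" "b \<in> B" "b \<in> Q" "d \<in> C" "d \<in> Q"
  shows False
proof -
  obtain M p where M: "Q \<subseteq> M" "buoy_on G M p"
    and mod: "\<And>v. v \<in> V \<Longrightarrow> v \<notin> M \<Longrightarrow> (\<forall>x\<in>M. E v x) \<or> (\<forall>x\<in>M. \<not> E v x)"
    using C5_in_buoy_module[OF c] unfolding Q by metis
  have MV: "M \<subseteq> V" "M \<noteq> {}" using M m by (auto simp: buoy_on_def)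
  have "M \<noteq> V" using M(2) no_buoy by metis
  define N where "N = {v \<in> V - M. \<forall>x\<in>M. E v x}"
  have W: "\<not> E x v" if "x \<in> M" "v \<in> V - M - N" for x v
    using mod[of v] that E_sym[of x v] by (auto simp: N_def)
  have "V - M \<noteq> {}" using MV \<open>M \<noteq> V\<close> by blast
  then have "\<exists>x\<in>M. \<exists>y\<in>V - M. \<not> E x y" using MV by (intro no_join) blast+
  then have "V - M - N \<noteq> {}" using E_sym by (auto simp: N_def)
  then have "separation G N M (V - M - N)"
    unfolding separation_def using MV W by (auto simp: N_def)
  then have "card C \<le> card N" by (rule minimal)
  moreover have "N \<subseteq> C - {d}"
  proof
    fix v
    assume v: "v \<in> N"
    then have "E v a" "E v b" "v \<in> V" "v \<noteq> d" using M(1) m by (auto simp: N_def)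
    then show "v \<in> C - {d}" using sepD(4)[of v] sepD(5)[of v b] sepD(6)[of a v] m by blast
  qed
  then have "card N \<le> card (C - {d})" using finC by (intro card_mono) auto
  moreover have "card (C - {d}) < card C" using finC m(5) by (rule card_Diff1_less)
  ultimately show False by linarith
qed

text \<open>By \<open>comp_full\<close> both \<open>d\<close> and \<open>d'\<close> have neighbours
  in the component, so they are connected through it, and \<open>P5_free_distance\<close> leaves two
  or three edges.\<close>

lemma path_through_comp:
  assumes a: "a \<in> A" and d: "d \<in> C" "d' \<in> C" "d \<noteq> d'" "\<not> E d d'"
  shows "(\<exists>p\<in>side a. E d p \<and> E p d') \<or>
    (\<exists>p\<in>side a. \<exists>q\<in>side a. E d p \<and> E p q \<and> E q d' \<and> \<not> E d q \<and> \<not> E p d')"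
proof -
  let ?X = "insert d (insert d' (side a))"
  let ?R = "{(u, w). u \<in> ?X \<and> w \<in> ?X \<and> E u w}"
  obtain y y' where y: "y \<in> side a" "E d y" "y' \<in> side a" "E d' y'"
    using comp_full[OF a d(1)] comp_full[OF a d(2)] by blast
  have "(y, y') \<in> {(u, w). u \<in> side a \<and> w \<in> side a \<and> E u w}\<^sup>*"
    by (rule component_connected[OF simple y(1,3)])
  then have yy: "(y, y') \<in> ?R\<^sup>*" by (rule rtrancl_mono[THEN subsetD, rotated]) auto
  have dy: "(d, y) \<in> ?R" "(y', d') \<in> ?R" using y E_sym[of y' d'] by auto
  have "(d, d') \<in> ?R\<^sup>*"
    by (rule converse_rtrancl_into_rtrancl[OF dy(1) rtrancl_into_rtrancl[OF yy dy(2)]])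
  from P5_free_distance[OF this] d(3,4) consider p where "p \<in> ?X" "E d p" "E p d'"
    | p q where "p \<in> ?X" "q \<in> ?X" "E d p" "E p q" "E q d'" "\<not> E d q" "\<not> E p d'"
    by blast
  then show ?thesis
  proof cases
    case 1
    then have "p \<noteq> d" "p \<noteq> d'" using E_irrefl by metis+
    then show ?thesis using 1 by blast
  next
    case 2
    have "p \<noteq> d" "p \<noteq> d'" "q \<noteq> d" "q \<noteq> d'" using 2 d(4) E_irrefl by metis+
    then show ?thesis using 2 by blast
  qed
qed

lemma common_neighbours:
  assumes a: "a \<in> A" and b: "b \<in> B" and d: "d \<in> C" "d' \<in> C" "d \<noteq> d'" "\<not> E d d'"
  obtains p q where "p \<in> side a" "E p d" "E p d'" "q \<in> side b" "E q d" "E q d'"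
proof -
  interpret sw: prime_cut G C B A by (rule prime_cut_swap)
  have AB: "side a \<subseteq> A" "side b \<subseteq> B"
    using separation_component[OF sep a] separation_component[OF sw.sep b] .
  have dd: "\<not> E d' d" using d(4) E_sym by blast
  consider p q where "p \<in> side a" "E d p" "E p d'" "q \<in> side b" "E d q" "E q d'"
    | p q r where "p \<in> side a" "E d p" "E p d'" "q \<in> side b" "r \<in> side b" "E d q" "E q r" "E r d'"
      "\<not> E d r" "\<not> E q d'"
    | p q r where "p \<in> side b" "E d p" "E p d'" "q \<in> side a" "r \<in> side a" "E d q" "E q r" "E r d'"
      "\<not> E d r" "\<not> E q d'"
    | p q r s where "p \<in> side a" "q \<in> side a" "E d p" "E p q" "E q d'" "\<not> E d q" "\<not> E p d'"
      "r \<in> side b" "s \<in> side b" "E d r" "E r s" "E s d'" "\<not> E d s" "\<not> E r d'"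
    using path_through_comp[OF a d] sw.path_through_comp[OF b d] by blast
  then show thesis
  proof cases
    case 1
    then show thesis using that[of p q] E_sym[of p d] E_sym[of q d] by simp
  next
    case 2
    have "\<not> E p r" "\<not> E p q" using sepD(5) 2 AB by blast+
    then have "ind_C5 d p d' r q"
      using 2 d(4) E_sym[of d' r] E_sym[of r q] E_sym[of q d] E_sym[of d' q] by (simp add: ind_C5_def)
    then have False using no_crossing_C5[OF _ refl, of d p d' r q p q d] 2 d AB by blast
    then show thesis ..
  next
    case 3
    have "\<not> E p r" "\<not> E p q" using sepD(6) 3 AB by blast+
    then have "ind_C5 d p d' r q"
      using 3 d(4) E_sym[of d' r] E_sym[of r q] E_sym[of q d] E_sym[of d' q] by (simp add: ind_C5_def)
    then have False using no_crossing_C5[OF _ refl, of d p d' r q q p d] 3 d AB by blast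
    then show thesis ..
  next
    case 4
    \<comment> \<open>The two paths form a 6-cycle; leaving out \<open>d\<close> gives an induced
      path.\<close>
    have "\<not> E p r" "\<not> E p s" "\<not> E q r" "\<not> E q s" using sepD(5) 4 AB by blast+
    then have "ind_P5 G p q d' s r"
      using 4 E_sym[of d' s] E_sym[of s r] E_sym[of d' r] by (simp add: ind_P5_def)
    then show thesis using noP5 by blast
  qed
qed

text \<open>If \<open>a\<close> saw exactly one of \<open>d\<close> and \<open>d'\<close>, follow an
  induced path of at most three edges inside \<open>side a\<close> from \<open>a\<close> to a common
  neighbour \<open>y\<close>. Passing from one seen vertex to two along it produces a house or an
  induced path, mostly with the help of a common neighbour \<open>z\<close> beyond the
  cutset.\<close>

lemma nonadjacent_twins:
  assumes a: "a \<in> A" and d: "d \<in> C" "d' \<in> C" "d \<noteq> d'" "\<not> E d d'"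
  shows "E a d \<longleftrightarrow> E a d'"
proof (rule ccontr)
  interpret sw: prime_cut G C B A by (rule prime_cut_swap)
  assume one_a: "E a d \<noteq> E a d'"
  obtain b where b: "b \<in> B" using sep by (auto simp: separation_def)
  obtain y z where yz: "y \<in> side a" "E y d" "E y d'" "z \<in> side b" "E z d" "E z d'"
    using common_neighbours[OF a b d] by metis
  have AB: "side a \<subseteq> A" "side b \<subseteq> B"
    using separation_component[OF sep a] separation_component[OF sw.sep b] .
  have nz: "\<not> E x z" "\<not> E z x" if "x \<in> side a" for x
    using sepD(5,6) AB that yz(4) by blast+
  have zd: "E d z" "E d' z" "\<not> E d' d" using yz(5,6) d(4) E_sym by blast+
  \<comment> \<open>\<open>w, d, z, d'\<close> is a 4-cycle, and \<open>u\<close> is a roof over the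
    edge from \<open>w\<close> to the one of \<open>d\<close> and \<open>d'\<close> that it
    sees.\<close>
  have no_edge: False
    if h: "u \<in> side a" "w \<in> side a" "E u d \<noteq> E u d'" "E w d" "E w d'" "E u w" for u w
  proof (cases "E u d")
    case True
    then have "ind_house G w z u d' d"
      using h nz yz(5,6) zd(3) E_sym[of w u] by (simp add: ind_house_def)
    then show False using nohouse by blast
  next
    case False
    then have "ind_house G w z u d d'"
      using h nz yz(5,6) d(4) E_sym[of w u] by (simp add: ind_house_def)
    then show False using nohouse by blast
  qed
  \<comment> \<open>If \<open>p\<close> sees \<open>d\<close> or \<open>d'\<close>, an edge of the
    path already contradicts \<open>no_edge\<close>. If it sees neither, the path continues from
    \<open>w\<close> through the vertex that \<open>u\<close> does not see to
    \<open>z\<close>.\<close>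
  have no_two_path: False
    if h: "u \<in> side a" "w \<in> side a" "p \<in> side a" "E u d \<noteq> E u d'" "E w d" "E w d'" "E u p" "E p w" "\<not> E u w"
    for u w p
  proof -
    consider "E p d" "E p d'" | "E p d \<noteq> E p d'" | "\<not> E p d" "\<not> E p d'" by blast
    then show False
    proof cases
      case 1
      then show False using no_edge[of u p] h by blast
    next
      case 2
      then show False using no_edge[of p w] h by blast
    next
      case 3
      show False
      proof (cases "E u d")
        case True
        then have "ind_P5 G u p w d' z" using h 3 nz zd by (simp add: ind_P5_def)
        then show False using noP5 by blast
      next
        case False
        then have "ind_P5 G u p w d z" using h 3 nz zd by (simp add: ind_P5_def)
        then show False using noP5 by blast
      qed
    qed
  qed
  have ac: "a \<in> side a" by (rule component_self)
  have "(a, y) \<in> {(u, w). u \<in> side a \<and> w \<in> side a \<and> E u w}\<^sup>*"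
    by (rule component_connected[OF simple ac yz(1)])
  then consider "a = y" | "E a y" | p where "p \<in> side a" "E a p" "E p y" "\<not> E a y"
    | p q where "p \<in> side a" "q \<in> side a" "E a p" "E p q" "E q y" "\<not> E a q" "\<not> E a y" "\<not> E p y"
    using P5_free_distance[of a y "side a"] by blast
  then show False
  proof cases
    case 1
    then show False using one_a yz by blast
  next
    case 2
    then show False using no_edge[OF ac yz(1) one_a yz(2,3)] by blast
  next
    case 3
    then show False using no_two_path[OF ac yz(1) _ one_a yz(2,3)] by blast
  next
    case 4
    consider "E q d" "E q d'" | "E q d \<noteq> E q d'" | "\<not> E q d" "\<not> E q d'" by blast
    then show False
    proof cases
      case 1
      then show False using no_two_path[OF ac 4(2,1) one_a] 4 by blast
    next
      case 2
      then show False using no_edge[OF 4(2) yz(1) _ yz(2,3)] 4 by blast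
    next
      case 3
      consider "E p d" "E p d'" | "E p d \<noteq> E p d'" | "\<not> E p d" "\<not> E p d'" by blast
      then show False
      proof cases
        case 1
        then show False using no_edge[OF ac 4(1) one_a] 4 by blast
      next
        case 2
        then show False using no_two_path[OF 4(1) yz(1) 4(2) _ yz(2,3)] 4 by blast
      next
        \<comment> \<open>Now neither \<open>p\<close> nor \<open>q\<close> sees \<open>d\<close> or
          \<open>d'\<close>, and the path from \<open>a\<close> to \<open>y\<close> extends to the
          one that \<open>a\<close> does not see.\<close>
        case p: 3
        show False
        proof (cases "E a d")
          case True
          then have "ind_P5 G a p q y d'" using one_a yz 3 4 p by (simp add: ind_P5_def)
          then show False using noP5 by blast
        next
          case False
          then have "ind_P5 G a p q y d" using one_a yz 3 4 p by (simp add: ind_P5_def)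
          then show False using noP5 by blast
        qed
      qed
    qed
  qed
qed

end

section \<open>Gluing colourings along a cutset\<close>

text \<open>Equal colour classes on \<open>C\<close> make the passage from \<open>f x\<close> to
  \<open>f' x\<close> a well-defined injection, and equally many colours are left over on both
  sides.\<close>

lemma extend_to_permutation:
  fixes f f' :: "'a \<Rightarrow> nat"
  assumes f: "f ` C \<subseteq> {..<K}" "f' ` C \<subseteq> {..<K}"
    and k: "\<And>x y. x \<in> C \<Longrightarrow> y \<in> C \<Longrightarrow> f x = f y \<longleftrightarrow> f' x = f' y"
  obtains s where "bij_betw s {..<K} {..<K}" "\<And>x. x \<in> C \<Longrightarrow> s (f x) = f' x"
proof -
  define r where "r n = f' (SOME x. x \<in> C \<and> f x = n)" for n
  have r: "r (f x) = f' x" if "x \<in> C" for x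
  proof -
    have "(SOME y. y \<in> C \<and> f y = f x) \<in> C \<and> f (SOME y. y \<in> C \<and> f y = f x) = f x"
      by (rule someI[of _ x]) (use that in simp)
    then show ?thesis unfolding r_def using k that by blast
  qed
  have "inj_on r (f ` C)" using r k by (auto simp: inj_on_def)
  moreover have "r ` f ` C = f' ` C" using r by (auto simp: image_image)
  ultimately have b1: "bij_betw r (f ` C) (f' ` C)" by (simp add: bij_betw_def)
  have fin: "finite (f ` C)" "finite (f' ` C)" using f finite_subset by blast+
  have "card ({..<K} - f ` C) = card ({..<K} - f' ` C)"
    using f fin bij_betw_same_card[OF b1] by (simp add: card_Diff_subset)
  then obtain t where b2: "bij_betw t ({..<K} - f ` C) ({..<K} - f' ` C)"
    using finite_same_card_bij[of "{..<K} - f ` C" "{..<K} - f' ` C"] by auto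
  let ?s = "\<lambda>n. if n \<in> f ` C then r n else t n"
  have "bij_betw ?s (f ` C) (f' ` C)" using b1 by (rule bij_betw_cong[THEN iffD1, rotated]) simp
  moreover have "bij_betw ?s ({..<K} - f ` C) ({..<K} - f' ` C)"
    using b2 by (rule bij_betw_cong[THEN iffD1, rotated]) simp
  ultimately have "bij_betw ?s (f ` C \<union> ({..<K} - f ` C)) (f' ` C \<union> ({..<K} - f' ` C))"
    by (rule bij_betw_combine) blast
  then have "bij_betw ?s {..<K} {..<K}" using f by (simp add: Un_absorb1)
  then show thesis by (rule that) (use r in simp)
qed

text \<open>A module can be recoloured with any optimal colouring of its own, using only colours it
  already has. Doing this for all co-components of the cutset \<open>C\<close> gives both sides colourings with
  the same colour classes on \<open>C\<close>, so that they can be glued after a permutation of colours.\<close>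

lemma chi_glue:
  assumes G: "simple_graph G" and sep: "separation G C A B"
    and mod: "\<And>x y v. x \<in> C \<Longrightarrow> y \<in> C \<Longrightarrow> x \<noteq> y \<Longrightarrow> \<not> adj G x y \<Longrightarrow> v \<in> A \<union> B \<Longrightarrow> adj G v x \<longleftrightarrow> adj G v y"
    and K: "chi G (A \<union> C) \<le> K" "chi G (B \<union> C) \<le> K"
  shows "chi G (verts G) \<le> K"
proof -
  let ?V = "verts G" and ?E = "adj G"
  \<comment> \<open>Nonadjacency within \<open>C\<close>; thus \<open>D x\<close> is the
    co-component of \<open>x\<close>.\<close>
  let ?S = "{(x, y). x \<in> C \<and> y \<in> C \<and> x \<noteq> y \<and> \<not> ?E x y}"
  define D where "D x = ?S\<^sup>* `` {x}" for x
  have V: "A \<union> B \<union> C = ?V" and AC: "A \<inter> C = {}" and BC: "B \<inter> C = {}"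
    and AB: "\<And>x y. x \<in> A \<Longrightarrow> y \<in> B \<Longrightarrow> \<not> ?E x y"
    using sep by (simp_all add: separation_def)
  have sub: "A \<union> C \<subseteq> ?V" "B \<union> C \<subseteq> ?V" "C \<subseteq> ?V" using V by blast+
  have sym: "?E x y \<longleftrightarrow> ?E y x" for x y by (rule simple_graphD(4)[OF G])
  have "sym ?S" using sym by (auto simp: sym_def)
  then have symS: "(x, y) \<in> ?S\<^sup>* \<Longrightarrow> (y, x) \<in> ?S\<^sup>*" for x y by (rule symD[OF sym_rtrancl])
  have D_self: "x \<in> D x" for x by (simp add: D_def)
  have D_eq: "D y = D x" if "y \<in> D x" for x y
    using that symS[of x y] unfolding D_def by (auto intro: rtrancl_trans)
  have D_C: "D x \<subseteq> C" if x: "x \<in> C" for x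
  proof
    fix y
    assume "y \<in> D x"
    then have "(x, y) \<in> ?S\<^sup>*" by (simp add: D_def)
    then show "y \<in> C" by (induction rule: rtrancl_induct) (use x in auto)
  qed
  have D_mod: "?E v x \<longleftrightarrow> ?E v y" if y: "y \<in> D x" and v: "v \<in> A \<union> B" for x y v
  proof -
    have "(x, y) \<in> ?S\<^sup>*" using y by (simp add: D_def)
    then show ?thesis
    proof (induction rule: rtrancl_induct)
      case (step y z)
      then show ?case using mod[of y z v] v by simp
    qed simp
  qed
  have D_complete: "?E x y" if "x \<in> C" "y \<in> C" "D x \<noteq> D y" for x y
  proof (rule ccontr)
    assume n: "\<not> ?E x y"
    have "x \<noteq> y" using that(3) by blast
    then have "(x, y) \<in> ?S" using that n by simp
    then have "y \<in> D x" by (auto simp: D_def)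
    then show False using D_eq that(3) by blast
  qed
  have "\<exists>c. proper G X c \<and> c ` X \<subseteq> {..<chi G X}" if X: "X \<subseteq> ?V" for X
  proof -
    obtain c where "proper G X c" "c ` X \<subseteq> {..<chi G X}"
      using chi_colouring[OF G X, of "{..<chi G X}"] by auto
    then show ?thesis by blast
  qed
  then obtain opt where opt: "\<And>X. X \<subseteq> ?V \<Longrightarrow> proper G X (opt X)"
    "\<And>X. X \<subseteq> ?V \<Longrightarrow> opt X ` X \<subseteq> {..<chi G X}" by metis
  \<comment> \<open>One optimal colouring per co-component, chosen before either side is considered:
    it fixes the colour classes that both sides will have on \<open>C\<close>.\<close>
  define g where "g x = opt (D x) x" for x
  have DV: "D x \<subseteq> ?V" if "x \<in> C" for x using D_C[OF that] sub by blast
  have g_proper: "g x \<noteq> g y" if "x \<in> C" "y \<in> D x" "?E x y" for x y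
    using opt(1)[OF DV[OF that(1)]] D_self[of x] that D_eq[OF that(2)] unfolding proper_def g_def by metis
  have g_less: "g x < chi G (D x)" if "x \<in> C" for x
    using opt(2)[OF DV[OF that]] D_self[of x] by (auto simp: g_def)
  have recolour: "\<exists>f'. proper G (U \<union> C) f' \<and> f' ` (U \<union> C) \<subseteq> {..<K} \<and>
      (\<forall>x\<in>C. \<forall>y\<in>C. f' x = f' y \<longleftrightarrow> D x = D y \<and> g x = g y)"
    if U: "U \<subseteq> A \<union> B" and chiU: "chi G (U \<union> C) \<le> K" for U
  proof -
    have UV: "U \<union> C \<subseteq> ?V" and UC: "U \<inter> C = {}" using U V AC BC by blast+
    obtain f where f: "proper G (U \<union> C) f" "f ` (U \<union> C) \<subseteq> {..<K}"
      using chi_colouring[OF G UV, of "{..<K}"] chiU by auto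
    \<comment> \<open>On \<open>X\<close> the colouring \<open>f\<close> uses at least
      \<open>chi G X\<close> colours, so optimal colours of \<open>X\<close> can be renamed to
      colours already in use there.\<close>
    have "\<exists>h. h ` {..<chi G X} \<subseteq> f ` X \<and> inj_on h {..<chi G X}" if X: "X \<subseteq> C" for X
    proof -
      have XV: "X \<subseteq> ?V" using X sub by blast
      have "proper G X f" by (rule proper_subset[OF f(1)]) (use X in blast)
      then have "chi G X \<le> card (f ` X)" using chi_le_card[OF G XV] by blast
      moreover have "finite (f ` X)"
        using XV simple_graphD(1)[OF G] finite_subset by (metis finite_imageI)
      ultimately show ?thesis using card_le_inj[of "{..<chi G X}" "f ` X"] by auto
    qed
    then obtain h where h: "\<And>X. X \<subseteq> C \<Longrightarrow> h X ` {..<chi G X} \<subseteq> f ` X"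
      "\<And>X. X \<subseteq> C \<Longrightarrow> inj_on (h X) {..<chi G X}" by metis
    define f' where "f' x = (if x \<in> C then h (D x) (g x) else f x)" for x
    have f'C: "\<exists>u\<in>D x. f' x = f u" if x: "x \<in> C" for x
    proof -
      have "h (D x) (g x) \<in> f ` D x" using h(1)[OF D_C[OF x]] g_less[OF x] by blast
      then show ?thesis using x by (auto simp: f'_def)
    qed
    have f'U: "f' x = f x" if "x \<in> U" for x using that UC by (auto simp: f'_def)
    have fne: "f x \<noteq> f y" if "x \<in> U \<union> C" "y \<in> U \<union> C" "?E x y" for x y
      using f(1) that by (simp add: proper_def)
    \<comment> \<open>Different co-components are completely joined, so \<open>f\<close> keeps their
      colours apart, and the new colours of each are among its old ones.\<close>
    have diff: "f' x \<noteq> f' y" if xy: "x \<in> C" "y \<in> C" "D x \<noteq> D y" for x y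
    proof -
      obtain u w where uw: "u \<in> D x" "f' x = f u" "w \<in> D y" "f' y = f w" using f'C xy by metis
      have C: "u \<in> C" "w \<in> C" using uw D_C xy by blast+
      have "D u \<noteq> D w" using D_eq uw xy by metis
      then have "?E u w" using D_complete C by blast
      then show ?thesis using fne[of u w] C uw by simp
    qed
    have same: "f' x = f' y \<longleftrightarrow> g x = g y" if xy: "x \<in> C" "y \<in> C" "D x = D y" for x y
      using inj_onD[OF h(2)[OF D_C[OF xy(1)]], of "g x" "g y"] g_less[OF xy(1)] g_less[OF xy(2)] xy
      by (auto simp: f'_def)
    \<comment> \<open>The new colour of \<open>x\<close> is the old colour of some \<open>u\<close>
      in its co-component, and \<open>y\<close> sees \<open>u\<close> too because co-components are
      modules.\<close>
    have cross: "f' x \<noteq> f' y" if xy: "x \<in> C" "y \<in> U" "?E x y" for x y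
    proof -
      obtain u where u: "u \<in> D x" "f' x = f u" using f'C xy by metis
      have "?E y u" using D_mod[OF u(1), of y] xy U sym[of x y] by blast
      moreover have "u \<in> C" using u D_C xy by blast
      ultimately show ?thesis using fne[of y u] u f'U xy by simp
    qed
    have "f' x \<noteq> f' y" if xy: "x \<in> U \<union> C" "y \<in> U \<union> C" "?E x y" for x y
    proof -
      consider "x \<in> C" "y \<in> C" | "x \<in> C" "y \<in> U" | "x \<in> U" "y \<in> C" | "x \<in> U" "y \<in> U" using xy by blast
      then show ?thesis
      proof cases
        case 1
        show ?thesis
        proof (cases "D x = D y")
          case True
          have "y \<in> D x" using True D_self by simp
          then show ?thesis using same[OF 1 True] g_proper[OF 1(1)] xy by blast
        qed (use diff 1 in blast)
      next
        case 2
        then show ?thesis using cross xy by blast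
      next
        case 3
        then show ?thesis using cross[of y x] xy sym by metis
      next
        case 4
        then show ?thesis using f'U fne xy by metis
      qed
    qed
    then have "proper G (U \<union> C) f'" by (simp add: proper_def)
    moreover have "f' ` (U \<union> C) \<subseteq> {..<K}"
    proof
      fix n
      assume "n \<in> f' ` (U \<union> C)"
      then obtain x where x: "x \<in> U \<union> C" "n = f' x" by blast
      then have "\<exists>u\<in>U \<union> C. n = f u" using f'C[of x] f'U[of x] D_C[of x] by blast
      then show "n \<in> {..<K}" using f(2) by blast
    qed
    moreover have "\<forall>x\<in>C. \<forall>y\<in>C. f' x = f' y \<longleftrightarrow> D x = D y \<and> g x = g y" using diff same by blast
    ultimately show ?thesis by blast
  qed
  obtain fA where fA: "proper G (A \<union> C) fA" "fA ` (A \<union> C) \<subseteq> {..<K}"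
    "\<And>x y. x \<in> C \<Longrightarrow> y \<in> C \<Longrightarrow> fA x = fA y \<longleftrightarrow> D x = D y \<and> g x = g y"
    using recolour[OF Un_upper1 K(1)] by (elim exE conjE) (rule that, auto)
  obtain fB where fB: "proper G (B \<union> C) fB" "fB ` (B \<union> C) \<subseteq> {..<K}"
    "\<And>x y. x \<in> C \<Longrightarrow> y \<in> C \<Longrightarrow> fB x = fB y \<longleftrightarrow> D x = D y \<and> g x = g y"
    using recolour[OF Un_upper2 K(2)] by (elim exE conjE) (rule that, auto)
  have "fA ` C \<subseteq> {..<K}" "fB ` C \<subseteq> {..<K}" using fA(2) fB(2) by blast+
  moreover have "fA x = fA y \<longleftrightarrow> fB x = fB y" if "x \<in> C" "y \<in> C" for x y
    using fA(3)[OF that] fB(3)[OF that] by simp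
  ultimately have "\<exists>s. bij_betw s {..<K} {..<K} \<and> (\<forall>x\<in>C. s (fA x) = fB x)"
    by (rule extend_to_permutation) blast+
  then obtain s where s: "bij_betw s {..<K} {..<K}" "\<And>x. x \<in> C \<Longrightarrow> s (fA x) = fB x"
    by (elim exE conjE) (rule that, auto)
  \<comment> \<open>Vertices of \<open>C\<close> belong to both sides; the permutation
    \<open>s\<close> makes the two prescriptions agree there.\<close>
  define f where "f x = (if x \<in> A \<union> C then s (fA x) else fB x)" for x
  have fAC: "f x = s (fA x)" if "x \<in> A \<union> C" for x using that by (simp add: f_def)
  have disj: "A \<inter> B = {}" using sep by (simp add: separation_def)
  have fBC: "f x = fB x" if "x \<in> B \<union> C" for x using that s(2) disj by (auto simp: f_def)
  have "f x \<noteq> f y" if xy: "x \<in> ?V" "y \<in> ?V" "?E x y" for x y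
  proof -
    have "x \<in> A \<union> C \<and> y \<in> A \<union> C \<or> x \<in> B \<union> C \<and> y \<in> B \<union> C" using xy V AB sym by blast
    then show ?thesis
    proof
      assume h: "x \<in> A \<union> C \<and> y \<in> A \<union> C"
      then have "fA x \<noteq> fA y" "fA x \<in> {..<K}" "fA y \<in> {..<K}"
        using fA(1,2) xy by (auto simp: proper_def)
      then show ?thesis using h fAC s(1) by (metis bij_betw_def inj_onD)
    next
      assume h: "x \<in> B \<union> C \<and> y \<in> B \<union> C"
      then have "fB x \<noteq> fB y" using fB(1) xy by (auto simp: proper_def)
      then show ?thesis using h fBC by simp
    qed
  qed
  then have "proper G ?V f" by (simp add: proper_def)
  moreover have "f ` ?V \<subseteq> {..<K}"
  proof
    fix n
    assume "n \<in> f ` ?V"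
    then obtain x where x: "x \<in> ?V" "n = f x" by blast
    show "n \<in> {..<K}"
    proof (cases "x \<in> A \<union> C")
      case True
      then have "fA x \<in> {..<K}" using fA(2) by blast
      then show ?thesis using s(1) x fAC[OF True] by (auto simp: bij_betw_def)
    next
      case False
      then have "x \<in> B \<union> C" using x V by blast
      then show ?thesis using fB(2) fBC x by auto
    qed
  qed
  ultimately show ?thesis using chi_le_iff[OF G order_refl] colorable_induced[of ?V G K] by blast
qed

section \<open>The decomposition of critical graphs and the characterization\<close>

lemma critical_join_or_buoy:
  assumes G: "G \<in> critical_family k" and k: "k \<ge> 2"
  shows "(\<exists>p. blowup G p (\<lambda>_ _. True) \<and> p ` verts G = (UNIV :: bool set)) \<or>
    (\<exists>p. blowup G p C5 \<and> p ` verts G = {..<5})"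
proof (rule ccontr)
  assume n: "\<not> ?thesis"
  have s: "simple_graph G" and c: "critical k G" and f: "P5_coP5_free G"
    using G by (auto simp: critical_family_def)
  interpret free_graph G
    using P5_coP5_free_iff[OF s] f s by unfold_locales blast+
  have no_buoy: "\<not> buoy_on G V p" for p
  proof
    assume "buoy_on G V p"
    then have "blowup G p C5 \<and> p ` V = {..<5}" by (simp add: buoy_on_def blowup_def)
    then show False using n by blast
  qed
  have no_join: "\<exists>x\<in>X. \<exists>y\<in>Y. \<not> E x y"
    if X: "X \<noteq> {}" "Y \<noteq> {}" "X \<union> Y = V" "X \<inter> Y = {}" for X Y
  proof (rule ccontr)
    assume h: "\<not> (\<exists>x\<in>X. \<exists>y\<in>Y. \<not> E x y)"
    let ?p = "\<lambda>x. x \<in> X"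
    have "E x y" if "x \<in> V" "y \<in> V" "?p x \<noteq> ?p y" for x y
      using that h X(3) E_sym[of x y] by blast
    then have "blowup G ?p (\<lambda>_ _. True)" by (simp add: blowup_def)
    moreover have "?p ` V = UNIV"
    proof -
      obtain x y where "x \<in> X" "y \<in> Y" using X by blast
      then have "x \<in> V" "?p x" "y \<in> V" "\<not> ?p y" using X by blast+
      then have "b \<in> ?p ` V" for b by (cases b) (auto simp: image_iff)
      then show ?thesis by blast
    qed
    ultimately show False using n by blast
  qed
  have chi: "chi G V = k" "\<And>S. S \<subset> V \<Longrightarrow> chi G S \<le> k - 1" using c critical_iff[OF s] by simp_all
  have "V \<noteq> {}" using chi(1) chi_empty[OF s] k by auto
  then obtain x where x: "x \<in> V" by blast
  \<comment> \<open>A single vertex is 1-critical but neither a join nor a buoy; the bound on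
    \<open>k\<close> excludes it.\<close>
  have "V - {x} \<noteq> {}"
  proof
    assume "V - {x} = {}"
    then have "chi G V \<le> 0 + 1" using chi_remove[OF s order_refl, of x] chi_empty[OF s] by metis
    then show False using chi(1) k by simp
  qed
  then obtain y where y: "y \<in> V - {x}" "\<not> E x y"
    using no_join[of "{x}" "V - {x}"] x by blast
  \<comment> \<open>Two nonadjacent vertices are separated by all the others, so some cutset
    exists.\<close>
  have "separation G (V - {x, y}) {x} {y}" unfolding separation_def using x y by auto
  then have "\<exists>C. \<exists>A B. separation G C A B" by blast
  then obtain C where C: "\<exists>A B. separation G C A B"
    "\<And>C'. \<exists>A B. separation G C' A B \<Longrightarrow> card C \<le> card C'"
    using ex_has_least_nat[of "\<lambda>C. \<exists>A B. separation G C A B" _ card] by blast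
  then obtain A B where AB: "separation G C A B" by blast
  interpret prime_cut G C A B
    by unfold_locales (use AB C(2) no_join no_buoy in blast)+
  interpret sw: prime_cut G C B A by (rule prime_cut_swap)
  have "chi G V \<le> k - 1"
  proof (rule chi_glue[OF s AB])
    show "E v x \<longleftrightarrow> E v y" if "x \<in> C" "y \<in> C" "x \<noteq> y" "\<not> E x y" "v \<in> A \<union> B" for x y v
      using that nonadjacent_twins sw.nonadjacent_twins by blast
    \<comment> \<open>Each piece lacks the vertices of the opposite side, so criticality colours it
      with k - 1 colours.\<close>
    have "A \<union> C \<subset> V" "B \<union> C \<subset> V" using AB unfolding separation_def by blast+
    then show "chi G (A \<union> C) \<le> k - 1" "chi G (B \<union> C) \<le> k - 1" using chi(2) by blast+
  qed
  then show False using chi(1) k by simp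
qed

theorem theorem1:
  fixes k :: nat and G :: "'a graph"
  assumes "k \<ge> 2" and "simple_graph G"
  shows "G \<in> critical_family k \<longleftrightarrow>
    (\<exists>(k1 :: nat) (k2 :: nat). \<exists>(H1 :: 'a graph) (H2 :: 'a graph).
        k1 \<ge> 1 \<and> k2 \<ge> 1 \<and> k1 + k2 = k \<and>
        H1 \<in> critical_family k1 \<and> H2 \<in> critical_family k2 \<and>
        graph_iso G (graph_join H1 H2)) \<or>
    (\<exists>(B :: nat \<Rightarrow> 'a graph) (ks :: nat \<Rightarrow> nat).
        is_buoy G B \<and>
        (\<forall>i<5. ks i \<ge> 1 \<and> B i \<in> critical_family (ks i)) \<and>
        (\<forall>i<5. ks i + ks ((i + 1) mod 5) \<le> k - 1) \<and>
        (\<Sum>i<5. ks i) = 2 * k - 1)"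
  (is "_ \<longleftrightarrow> ?join \<or> ?buoy")
proof
  assume G: "G \<in> critical_family k"
  have k: "k \<ge> 1" using assms(1) by simp
  from critical_join_or_buoy[OF G assms(1)] show "?join \<or> ?buoy"
  proof
    assume "\<exists>p. blowup G p (\<lambda>_ _. True) \<and> p ` verts G = (UNIV :: bool set)"
    then obtain p where "blowup G p (\<lambda>_ _. True)" "p ` verts G = (UNIV :: bool set)" by blast
    then have ?join by (rule join_of_blowup[OF G k])
    then show ?thesis ..
  next
    assume "\<exists>p. blowup G p C5 \<and> p ` verts G = {..<5}"
    then obtain p where "blowup G p C5" "p ` verts G = {..<5}" by blast
    then have ?buoy by (rule buoy_of_blowup[OF G k])
    then show ?thesis ..
  qed
next
  assume "?join \<or> ?buoy"
  then show "G \<in> critical_family k"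
  proof
    assume ?join
    then obtain k1 k2 and H1 H2 :: "'a graph" where h: "k1 \<ge> 1" "k2 \<ge> 1" "k1 + k2 = k"
      "H1 \<in> critical_family k1" "H2 \<in> critical_family k2" "graph_iso G (graph_join H1 H2)"
      by blast
    show ?thesis
      using critical_family_iso[OF assms(2) _ h(6)] graph_join_critical_family[OF h(4,5,1,2)] h(3)
      by blast
  next
    assume ?buoy
    then obtain B :: "nat \<Rightarrow> 'a graph" and ks where h: "is_buoy G B"
      "\<forall>i<5. ks i \<ge> 1 \<and> B i \<in> critical_family (ks i)"
      "\<forall>i<5. ks i + ks ((i + 1) mod 5) \<le> k - 1" "(\<Sum>i<5. ks i) = 2 * k - 1"
      by (elim exE conjE) (rule that)
    have iso: "graph_iso G (substitute (cycle_graph 5) B)" using h(1) by (simp add: is_buoy_def)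
    show ?thesis
      using critical_family_iso[OF assms(2) _ iso] buoy_critical_family[of B ks k] h(2-4) by blast
  qed
qed

end
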